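(* Let $T$ and $V$ be any two length-$n$ reflection factorizations of elements in $G_7$. Then $T$ and $V$ are Hurwitz equivalent if and only if they factor the same element, generate the same subgroup $H$ of $G_7$, and have the same multiset of conjugacy classes (of $H$).
   Context: Let $G_7$ be the subgroup of $GL_2(\mathbb{C})$ generated by $s=\begin{bmatrix}1&0\\0&-1\end{bmatrix}$, $t=\frac14\begin{bmatrix}(1+\sqrt3)+(-1+\sqrt3)i & (1+\sqrt3)+(-1+\sqrt3)i\\ (-1+\sqrt3)-(1+\sqrt3)i & (1-\sqrt3)+(1+\sqrt3)i\end{bmatrix}$ and $u=t^{\top}$; it has presentation $\langle s,t,u\mid s^2=t^3=u^3=1,\ stu=ust=tus\rangle$ and order $144$. A reflection is a linear map $\mathbb{C}^2\to\mathbb{C}^2$ whose fixed space has dimension $1$. For a group $H\le G_7$, a reflection factorization of $g\in H$ of length $n$ is a tuple $(r_1,\dots,r_n)$ of reflections lying in $H$ with $r_1\cdots r_n=g$; it generates the subgroup $\langle r_1,\dots,r_n\rangle$. The Hurwitz move $\sigma_i$ ($1\le i<n$) sends $(r_1,\dots,r_n)$ to $(r_1,\dots,r_{i-1},r_{i+1},r_{i+1}^{-1}r_ir_{i+1},r_{i+2},\dots,r_n)$. Two factorizations are Hurwitz equivalent if one is obtained from the other by a finite sequence of Hurwitz moves; the Hurwitz orbit of $T$ is the set of factorizations Hurwitz equivalent to $T$. If a factorization $T$ generates the subgroup $H$, its multiset of conjugacy classes is the multiset of $H$-conjugacy classes of its entries (each class counted with the number of entries of $T$ lying in it). *)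

theory Defs
  imports "HOL-Analysis.Analysis" "HOL-Library.Multiset"
begin

type_synonym cmat = "complex^2^2"

definition mat2 :: "complex \<Rightarrow> complex \<Rightarrow> complex \<Rightarrow> complex \<Rightarrow> cmat" where
  "mat2 a b c d = (\<chi> i j. if i = 1 then (if j = 1 then a else b) else (if j = 1 then c else d))"

definition G7_s :: cmat where "G7_s = mat2 1 0 0 (-1)"

definition G7_t :: cmat where
  "G7_t = mat2
     ((1/4) * ((1 + of_real (sqrt 3)) + (-1 + of_real (sqrt 3)) * \<i>))
     ((1/4) * ((1 + of_real (sqrt 3)) + (-1 + of_real (sqrt 3)) * \<i>))
     ((1/4) * ((-1 + of_real (sqrt 3)) - (1 + of_real (sqrt 3)) * \<i>))
     ((1/4) * ((1 - of_real (sqrt 3)) + (1 + of_real (sqrt 3)) * \<i>))"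

definition G7_u :: cmat where "G7_u = transpose G7_t"

text \<open>Subgroup of GL_2(C) generated by a set S of invertible matrices.\<close>
inductive_set gen_grp :: "cmat set \<Rightarrow> cmat set" for S where
  one: "mat 1 \<in> gen_grp S"
| gen: "x \<in> S \<Longrightarrow> x \<in> gen_grp S"
| mul: "x \<in> gen_grp S \<Longrightarrow> y \<in> gen_grp S \<Longrightarrow> x ** y \<in> gen_grp S"
| inv: "x \<in> gen_grp S \<Longrightarrow> matrix_inv x \<in> gen_grp S"

definition G7 :: "cmat set" where "G7 = gen_grp {G7_s, G7_t, G7_u}"

text \<open>A reflection: fixed space (over C) has dimension 1.\<close>
definition is_reflection :: "cmat \<Rightarrow> bool" where
  "is_reflection A \<longleftrightarrow> vec.dim {v :: complex^2. A *v v = v} = 1"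

definition mat_prod_list :: "cmat list \<Rightarrow> cmat" where
  "mat_prod_list T = foldr (**) T (mat 1)"

text \<open>Hurwitz move sigma_{i+1} (0-indexed position i, requires i+1 < length T).\<close>
definition hurwitz_move :: "nat \<Rightarrow> cmat list \<Rightarrow> cmat list" where
  "hurwitz_move i T = T[i := T ! (i+1), i+1 := matrix_inv (T ! (i+1)) ** (T ! i) ** (T ! (i+1))]"

definition hurwitz_step :: "cmat list \<Rightarrow> cmat list \<Rightarrow> bool" where
  "hurwitz_step T T' \<longleftrightarrow> (\<exists>i. i + 1 < length T \<and> T' = hurwitz_move i T)"

definition hurwitz_equiv :: "cmat list \<Rightarrow> cmat list \<Rightarrow> bool" where
  "hurwitz_equiv T V \<longleftrightarrow> hurwitz_step\<^sup>*\<^sup>* T V"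

definition conj_class :: "cmat set \<Rightarrow> cmat \<Rightarrow> cmat set" where
  "conj_class H r = {matrix_inv h ** r ** h | h. h \<in> H}"

definition conj_class_mset :: "cmat list \<Rightarrow> cmat set multiset" where
  "conj_class_mset T = mset (map (conj_class (gen_grp (set T))) T)"

definition refl_fact_G7 :: "nat \<Rightarrow> cmat list \<Rightarrow> bool" where
  "refl_fact_G7 n T \<longleftrightarrow> length T = n \<and> (\<forall>r \<in> set T. is_reflection r \<and> r \<in> G7)"

end

theory Submission
  imports Defs
begin

text \<open>
  Up to scalars, the 22 reflections of the group are the Hurwitz unit quaternions of order 3 and 4,
  and conjugation only sees the quaternion.  So a factorization is a word of pairs (quaternion,
  scalar) on which pure braids act through the quaternions alone, leaving the scalars in place.  If the
  subgroup generated is abelian, Hurwitz moves are transpositions.  Otherwise one inducts on the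
  length: from two factorizations with the same invariants one splits off a common first entry so
  that the remaining entries still fail to commute (and still include an element of order 3, if
  there was one).  This is possible because a suitable short block of entries can be moved, within
  its pure braid orbit, to have any given quaternion of the right class in front, with at most one
  exception; two such sets of quaternions always meet.  Only finitely many
  blocks have to be examined, and words of length 2 and 3 finish the induction.
\<close>

text \<open>The generated subgroup and its conjugacy classes do not pass to the tail of a word, so
  the induction cannot run on them. It runs on data that tails do inherit: the product, the multiset
  of pairs (species, scalar), and the property \<open>good\<close>. An element of order 3 has to
  remain because moves on words of order 4 elements preserve the axes of the entries: there species
  and scalar are too coarse, and a separate induction uses axes. The classes themselves are never
  computed; any function preserved by conjugation inside the alphabet can be read off from them. The
  exceptional quaternion comes from the shortest blocks: a twist of \<open>(a, b)\<close> conjugates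
  both entries by \<open>a b\<close>. If this has order 3 modulo the centre, it fixes one of the
  four members of a class of order 3 elements and cycles the other three. A matrix determines
  quaternion and scalar only up to a common sign. The sign is fixed by the real part -1/2 for order
  3 and by the scalar \<open>\<i>\<close> for order 4.\<close>

section \<open>The quandle of order 3 and order 4 unit quaternions\<close>

text \<open>\<open>Tri\<close> stands for (-1 +- i +- j +- k)/2 and \<open>Quad\<close> for +-i, +-j, +-k; \<open>True\<close> is a minus sign.
  The order 3 elements form two conjugacy classes, told apart by the product of the three signs.\<close>

datatype axis = AI | AJ | AK
datatype core = Tri bool bool bool | Quad axis bool
datatype species = Pos | Neg | Invol

text \<open>\<open>x = (y = z)\<close> says that the number of minus signs is odd.\<close>

fun kind :: "core \<Rightarrow> species" where
  "kind (Tri x y z) = (if x = (y = z) then Neg else Pos)"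
| "kind (Quad _ _) = Invol"

fun turn :: "bool \<Rightarrow> axis \<Rightarrow> axis" where
  "turn True AI = AJ" | "turn True AJ = AK" | "turn True AK = AI"
| "turn False AI = AK" | "turn False AJ = AI" | "turn False AK = AJ"

fun bit :: "bool \<Rightarrow> bool \<Rightarrow> bool \<Rightarrow> axis \<Rightarrow> bool" where
  "bit x y z AI = x" | "bit x y z AJ = y" | "bit x y z AK = z"

text \<open>\<open>cj a b\<close> is \<open>b\<inverse> a b\<close>: conjugation by \<open>Tri\<close> permutes the axes cyclically up to signs.\<close>

fun cj :: "core \<Rightarrow> core \<Rightarrow> core" where
  "cj (Tri a b c) (Tri x y z) =
     (if kind (Tri x y z) = Pos
      then Tri (c \<noteq> (z \<noteq> x)) (a \<noteq> (x \<noteq> y)) (b \<noteq> (y \<noteq> z))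
      else Tri (b \<noteq> (y \<noteq> x)) (c \<noteq> (z \<noteq> y)) (a \<noteq> (x \<noteq> z)))"
| "cj (Quad e s) (Tri x y z) =
     (let f = turn (kind (Tri x y z) = Pos) e
      in Quad f (s \<noteq> (bit x y z e \<noteq> bit x y z f)))"
| "cj (Tri a b c) (Quad f _) =
     (case f of AI \<Rightarrow> Tri a (\<not> b) (\<not> c) | AJ \<Rightarrow> Tri (\<not> a) b (\<not> c) | AK \<Rightarrow> Tri (\<not> a) (\<not> b) c)"
| "cj (Quad e s) (Quad f _) = Quad e (s \<noteq> (e \<noteq> f))"

type_synonym quat = "int \<times> int \<times> int \<times> int"

fun qmul :: "quat \<Rightarrow> quat \<Rightarrow> quat" where
  "qmul (a, b, c, d) (a', b', c', d') =
     (a * a' - b * b' - c * c' - d * d', a * b' + b * a' + c * d' - d * c',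
      a * c' - b * d' + c * a' + d * b', a * d' + b * c' - c * b' + d * a')"

text \<open>Integer quaternions store doubled coordinates, so products pick up a factor 2.\<close>

definition sg :: "bool \<Rightarrow> int" where "sg b = (if b then - 1 else 1)"

fun qv :: "core \<Rightarrow> quat" where
  "qv (Tri x y z) = (-1, sg x, sg y, sg z)"
| "qv (Quad AI s) = (0, 2 * sg s, 0, 0)"
| "qv (Quad AJ s) = (0, 0, 2 * sg s, 0)"
| "qv (Quad AK s) = (0, 0, 0, 2 * sg s)"

definition cores :: "species \<Rightarrow> core list" where
  "cores k = (case k of
     Pos \<Rightarrow> [Tri False False False, Tri False True True, Tri True False True, Tri True True False]
   | Neg \<Rightarrow> [Tri True False False, Tri False True False, Tri False False True, Tri True True True]
   | Invol \<Rightarrow> [Quad AI False, Quad AI True, Quad AJ False, Quad AJ True, Quad AK False, Quad AK True])"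

lemma set_cores: "a \<in> set (cores k) \<longleftrightarrow> kind a = k"
proof (cases a)
  case (Tri x y z) then show ?thesis by (cases x; cases y; cases z; cases k) (simp_all add: cores_def)
next
  case (Quad e s) then show ?thesis by (cases e; cases s; cases k) (simp_all add: cores_def)
qed

text \<open>Turns a quantifier over \<open>core\<close> into a search through explicit lists, so
  that quantified statements can be decided by evaluation.\<close>

lemma all_core: "(\<forall>a. P a) \<longleftrightarrow> (\<forall>k\<in>{Pos, Neg, Invol}. \<forall>a\<in>set (cores k). P a)"
proof -
  have "k \<in> {Pos, Neg, Invol}" for k by (cases k) auto
  moreover have "a \<in> set (cores (kind a))" for a by (simp add: set_cores)
  ultimately show ?thesis by blast
qed

definition comm :: "core \<Rightarrow> core \<Rightarrow> bool" where "comm a b \<longleftrightarrow> cj a b = a"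

text \<open>The square of a Hurwitz move: the simplest pure braid, which keeps the scalars in place.\<close>

fun tw :: "core \<times> core \<Rightarrow> core \<times> core" where "tw (a, b) = (let c = cj a b in (c, cj b c))"

fun twist :: "nat \<Rightarrow> core list \<Rightarrow> core list" where
  "twist 0 (a # b # r) = (let c = cj a b in c # cj b c # r)"
| "twist (Suc i) (a # r) = a # twist i r"
| "twist _ r = r"

abbreviation twists :: "nat list \<Rightarrow> core list \<Rightarrow> core list" where "twists \<equiv> fold twist"

definition noncomm :: "core list \<Rightarrow> bool" where
  "noncomm cs \<longleftrightarrow> (\<exists>a\<in>set cs. \<exists>b\<in>set cs. \<not> comm a b)"

text \<open>Twists can bring every quaternion of the class of the first entry, except possibly one, to
  the front, leaving a tail with property \<open>P\<close>.\<close>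

definition spread :: "nat list list \<Rightarrow> (core list \<Rightarrow> bool) \<Rightarrow> core list \<Rightarrow> bool" where
  "spread ws P cs \<longleftrightarrow>
     (\<exists>s\<in>set (cores (kind (hd cs))). \<forall>r\<in>set (cores (kind (hd cs))).
        r = s \<or> (\<exists>w\<in>set ws. let t = twists w cs in hd t = r \<and> P (tl t)))"

definition good :: "core list \<Rightarrow> bool" where
  "good cs \<longleftrightarrow> noncomm cs \<and> (\<exists>c\<in>set cs. kind c \<noteq> Invol)"

fun axis_of :: "core \<Rightarrow> axis" where
  "axis_of (Quad e s) = e"
| "axis_of (Tri x y z) = AI"

section \<open>Facts about the 14 quaternions, checked by evaluation\<close>

declare all_core [code_unfold]

lemma qmul_cj: "\<forall>a b. qmul (qv a) (qv b) = qmul (qv b) (qv (cj a b))"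
  by code_simp

lemma comm_sym: "\<forall>a b. comm a b \<longrightarrow> comm b a"
  by code_simp

lemma comm_cj_same: "\<forall>a b. comm (cj a b) b \<longrightarrow> cj a b = a"
  by code_simp

text \<open>The centralizer of an element of order 3 in the binary tetrahedral group is cyclic of
  order 6, hence commutative.\<close>

lemma comm_trans: "\<forall>b. kind b \<noteq> Invol \<longrightarrow> (\<forall>a c. comm a b \<longrightarrow> comm b c \<longrightarrow> comm a c)"
  by code_simp

lemma comm_kind: "\<forall>a b. comm a b \<longrightarrow> (kind a = Invol \<longleftrightarrow> kind b = Invol)"
  by code_simp

lemma kind_cj: "\<forall>a b. kind (cj a b) = kind a"
  by code_simp

text \<open>Modulo the centre \<open>b\<close> has order 2 or 3, and 6 is a common multiple.
  Conjugation can thus be inverted by iterating it.\<close>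

lemma cj_period: "\<forall>a b. ((\<lambda>a. cj a b) ^^ 6) a = a"
  by code_simp

text \<open>\<open>tw\<close> conjugates both entries by their product, which has order 1, 2 or 3
  modulo the centre. This is what makes Hurwitz moves reversible by further Hurwitz moves.\<close>

lemma tw_period: "\<forall>a b. (tw ^^ 6) (a, b) = (a, b)"
  by code_simp

lemma comm_Invol:
  "\<forall>a\<in>set (cores Invol). \<forall>b\<in>set (cores Invol). comm a b \<longleftrightarrow> axis_of a = axis_of b"
  by code_simp

lemma axis_cj:
  "\<forall>a\<in>set (cores Invol). \<forall>b\<in>set (cores Invol). axis_of (cj a b) = axis_of a"
  by code_simp

text \<open>Conjugation by a unit on another axis negates \<open>a\<close>, so one twist reaches the
  only other quaternion on its axis.\<close>

lemma twist_Invol: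
  "\<forall>a\<in>set (cores Invol). \<forall>b\<in>set (cores Invol). \<forall>r\<in>set (cores Invol).
     if axis_of a = axis_of b \<or> axis_of r \<noteq> axis_of a then True
     else \<exists>w\<in>{[], [0]}. hd (twists w [a, b]) = r \<and> map axis_of (tl (twists w [a, b])) = [axis_of b]"
  by code_simp

text \<open>Given the axes, equal products force the two signs to agree or to change together, and a
  twist changes both.\<close>

lemma pair_Invol:
  "\<forall>a\<in>set (cores Invol). \<forall>b\<in>set (cores Invol). \<forall>c\<in>set (cores Invol). \<forall>d\<in>set (cores Invol).
     if axis_of a \<noteq> axis_of b \<and> axis_of a = axis_of c \<and> axis_of b = axis_of d then
       if qmul (qv a) (qv b) = qmul (qv c) (qv d) then \<exists>w\<in>{[], [0]}. twists w [a, b] = [c, d]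
       else True
     else True"
  by code_simp

text \<open>A twist is conjugation by the product, of order at most 3 modulo the centre, so two
  twists exhaust an orbit. The point is that pairs with equal product and equal species lie in one
  orbit.\<close>

lemma pair_orbit:
  "\<forall>k\<in>{Pos, Neg}. \<forall>l\<in>{Pos, Neg, Invol}.
   \<forall>a\<in>set (cores k). \<forall>b\<in>set (cores l). if comm a b then True else
   (\<forall>c\<in>set (cores k). \<forall>d\<in>set (cores l). if qmul (qv a) (qv b) = qmul (qv c) (qv d)
      then \<exists>w\<in>{[], [0], [0, 0]}. twists w [a, b] = [c, d] else True)"
  by code_simp

text \<open>Three entries of one class form a base case of their own, since
  \<open>spread_uniform\<close> starts at length 4. The braid words are witnesses for the finite
  check.\<close>

lemma triple_orbit:
  "\<forall>k\<in>{Pos, Neg}.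
   \<forall>a\<in>set (cores k). \<forall>b\<in>set (cores k). \<forall>c\<in>set (cores k). if \<not> noncomm [a, b, c] then True else
   (\<forall>a'\<in>set (cores k). \<forall>b'\<in>set (cores k). \<forall>c'\<in>set (cores k).
      if qmul (qmul (qv a) (qv b)) (qv c) = qmul (qmul (qv a') (qv b')) (qv c')
      then \<exists>w\<in>{[], [0, 1], [1, 0], [0, 1, 1, 0], [1, 0, 0, 1], [0, 0, 1, 1], [1, 1, 0, 0],
                  [0, 0, 1, 0, 0], [0, 1, 0, 0, 1], [0, 0, 1], [0, 1, 0], [0, 1, 1]}.
             twists w [a, b, c] = [a', b', c']
      else True)"
  by code_simp

text \<open>The product of the two is, up to sign, an element of order 3 that does not commute with
  \<open>a\<close>; conjugation by it carries \<open>a\<close> through three of the four members of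
  its class. The tail, a single entry, cannot be \<open>good\<close> yet, so only its species is
  recorded.\<close>

lemma spread_Tri_Quad:
  "\<forall>k\<in>{Pos, Neg}. \<forall>a\<in>set (cores k). \<forall>b\<in>set (cores Invol).
     spread [[], [0], [0, 0]] (\<lambda>t. map kind t = [Invol]) [a, b]"
  by code_simp

text \<open>Pure braids keep the species at each position, so the tail is a \<open>Tri\<close>
  followed by a \<open>Quad\<close>, and such elements never commute.\<close>

lemma spread_Quad_Tri_Quad:
  "\<forall>k\<in>{Pos, Neg}. \<forall>a\<in>set (cores Invol). \<forall>b\<in>set (cores k). \<forall>c\<in>set (cores Invol).
     spread [[], [0], [0, 0], [1, 0], [0, 1, 0], [0, 0, 1, 0], [1, 0, 0], [1, 1, 0], [0, 1, 0, 0]]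
       good [a, b, c]"
  by code_simp

text \<open>The tail has one element of each class of order 3. These may be inverse to each other
  and then commute, so the braid words have to avoid such tails.\<close>

lemma spread_mixed:
  "\<forall>(k, l)\<in>{(Pos, Neg), (Neg, Pos)}.
   \<forall>a\<in>set (cores k). \<forall>b\<in>set (cores k). \<forall>c\<in>set (cores l).
     if noncomm [a, b, c]
     then spread [[], [0, 1, 0], [0], [0, 0], [0, 1, 0, 0], [1, 0]] good [a, b, c] else True"
  by code_simp

text \<open>Inside one class of order 3 only equal elements commute, so a tail is
  \<open>good\<close> as soon as it is not constant.\<close>

lemma spread_uniform:
  "\<forall>k\<in>{Pos, Neg}.
   \<forall>a\<in>set (cores k). \<forall>b\<in>set (cores k). \<forall>c\<in>set (cores k). \<forall>d\<in>set (cores k).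
     if noncomm [a, b, c, d]
     then spread [[], [0], [0, 0], [1, 0, 0], [2, 1, 1, 0], [1, 0], [0, 1, 1, 0], [2, 1, 1, 0, 0]]
       good [a, b, c, d] else True"
  by code_simp

declare all_core [code_unfold del]

section \<open>Quaternions as matrices\<close>

lemma matrix_inv_eq:
  fixes A B :: cmat
  assumes "A ** B = mat 1"
  shows "matrix_inv A = B"
proof -
  have BA: "B ** A = mat 1" using assms matrix_left_right_inverse by blast
  have "A ** matrix_inv A = mat 1 \<and> matrix_inv A ** A = mat 1"
    unfolding matrix_inv_def by (rule someI[of _ B]) (simp add: assms BA)
  then show ?thesis by (metis BA matrix_mul_assoc matrix_mul_lid matrix_mul_rid)
qed

lemma matrix_inv_both:
  fixes A :: cmat
  assumes "invertible A"
  shows "A ** matrix_inv A = mat 1" "matrix_inv A ** A = mat 1" "invertible (matrix_inv A)"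
proof -
  obtain B where B: "A ** B = mat 1" "B ** A = mat 1" using assms invertible_def by blast
  then have [simp]: "matrix_inv A = B" by (simp add: matrix_inv_eq)
  show "A ** matrix_inv A = mat 1" "matrix_inv A ** A = mat 1" "invertible (matrix_inv A)"
    using B by (auto simp: invertible_def)
qed

lemma mat2_mult:
  "mat2 a b c d ** mat2 e f g h = mat2 (a * e + b * g) (a * f + b * h) (c * e + d * g) (c * f + d * h)"
  by (simp add: mat2_def matrix_matrix_mult_def vec_eq_iff sum_2 forall_2)

lemma mat2_eq_iff: "mat2 a b c d = mat2 e f g h \<longleftrightarrow> a = e \<and> b = f \<and> c = g \<and> d = h"
  by (auto simp: mat2_def vec_eq_iff forall_2)

lemma mat_one_mat2: "mat 1 = mat2 1 0 0 1"
  by (simp add: mat2_def mat_def vec_eq_iff forall_2)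

text \<open>The usual embedding of the quaternions into complex 2 by 2 matrices, times
  \<open>z\<close>; the halves undo the doubling of coordinates.\<close>

fun qm :: "complex \<Rightarrow> quat \<Rightarrow> cmat" where
  "qm z (a, b, c, d) = mat2
     (z * (of_int a + of_int b * \<i>) / 2) (z * (of_int c + of_int d * \<i>) / 2)
     (z * (- of_int c + of_int d * \<i>) / 2) (z * (of_int a - of_int b * \<i>) / 2)"

lemma qm_mult: "qm z p ** qm w q = qm (z * w / 2) (qmul p q)"
proof -
  obtain a b c d where p: "p = (a, b, c, d)" by (cases p)
  obtain a' b' c' d' where q: "q = (a', b', c', d')" by (cases q)
  have i: "\<i> * (\<i> * x) = - x" for x by (metis i_squared mult.assoc mult_minus1)
  show ?thesis
    unfolding p q by (simp add: mat2_mult mat2_eq_iff) (simp add: i field_simps)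
qed

lemma gauss_eq_iff:
  "of_int a + of_int b * \<i> = of_int a' + of_int b' * \<i> \<longleftrightarrow> a = a' \<and> b = b'"
  by (auto simp: complex_eq_iff)

lemma qm_inject: "z \<noteq> 0 \<Longrightarrow> qm z p = qm z q \<longleftrightarrow> p = q"
  by (cases p; cases q) (auto simp: mat2_eq_iff gauss_eq_iff)

text \<open>The two sides of the conclusion are the traces of the two matrices.\<close>

lemma qm_trace_eq: "qm z (a, b, c, d) = qm w (a', b', c', d') \<Longrightarrow> z * of_int a = w * of_int a'"
proof -
  assume *: "qm z (a, b, c, d) = qm w (a', b', c', d')"
  have "z * of_int a = z * (of_int a + of_int b * \<i>) / 2 + z * (of_int a - of_int b * \<i>) / 2"
    by (simp add: field_simps)
  also have "\<dots> = w * (of_int a' + of_int b' * \<i>) / 2 + w * (of_int a' - of_int b' * \<i>) / 2"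
    using * by (simp only: qm.simps mat2_eq_iff)
  also have "\<dots> = w * of_int a'" by (simp add: field_simps)
  finally show ?thesis .
qed

lemma qm_uminus: "qm (- z) (a, b, c, d) = qm z (-a, -b, -c, -d)"
  by (simp add: mat2_eq_iff algebra_simps)

lemma qm_scale: "qm z (2 * a, 2 * b, 2 * c, 2 * d) = qm (2 * z) (a, b, c, d)"
  by (simp add: mat2_eq_iff algebra_simps)

fun qconj :: "quat \<Rightarrow> quat" where "qconj (a, b, c, d) = (a, - b, - c, - d)"

fun qnorm :: "quat \<Rightarrow> int" where "qnorm (a, b, c, d) = a * a + b * b + c * c + d * d"

lemma qmul_qconj: "qmul p (qconj p) = (qnorm p, 0, 0, 0)"
  by (cases p) (simp add: algebra_simps)

lemma qm_conj:
  assumes "z \<noteq> 0" "qnorm p = 4"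
  shows "qm z p ** qm (1 / z) (qconj p) = mat 1"
  using assms by (simp add: qm_mult qmul_qconj mat_one_mat2 mat2_eq_iff)

text \<open>The binary tetrahedral group with its 24 elements doubled. The order 4 elements already
  include their negatives; the negatives of the \<open>Tri\<close> and the elements 1 and -1 have to
  be added.\<close>

definition units :: "quat list" where
  "units = map qv (cores Pos @ cores Neg @ cores Invol)
     @ map (\<lambda>c. case qv c of (a, b, c, d) \<Rightarrow> (-a, -b, -c, -d)) (cores Pos @ cores Neg)
     @ [(2, 0, 0, 0), (-2, 0, 0, 0)]"

lemma units_qmul:
  "\<forall>p\<in>set units. \<forall>q\<in>set units. \<exists>(a, b, c, d)\<in>set units. qmul p q = (2 * a, 2 * b, 2 * c, 2 * d)"
  by code_simp

lemma units_qconj: "\<forall>p\<in>set units. qconj p \<in> set units \<and> qnorm p = 4"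
  by code_simp

definition rho :: "core \<times> complex \<Rightarrow> cmat" where "rho x = qm (snd x) (qv (fst x))"

text \<open>Selects one of the two sign choices: negating both quaternion and scalar gives the same
  matrix. A \<open>Tri\<close> is normalised by its real part, a \<open>Quad\<close> by its scalar,
  which in a reflection can only be \<open>\<i>\<close> or \<open>- \<i>\<close>.\<close>

definition valid :: "core \<times> complex \<Rightarrow> bool" where
  "valid x \<longleftrightarrow> snd x \<noteq> 0 \<and> (kind (fst x) = Invol \<longrightarrow> snd x = \<i>)"

lemma qv_norm: "qnorm (qv c) = 4"
  by (cases c rule: qv.cases) (auto simp: sg_def)

lemma qv_inject: "qv c = qv d \<longleftrightarrow> c = d"
proof -
  have "qv c = qv d \<Longrightarrow> c = d"
    by (cases c rule: qv.cases; cases d rule: qv.cases) (auto simp: sg_def split: if_splits)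
  then show ?thesis by blast
qed

lemma qv_real: "fst (qv c) = (if kind c = Invol then 0 else -1)"
  by (cases c rule: qv.cases) auto

text \<open>The trace of \<open>rho x\<close> recovers the scalar when the quaternion has order 3.\<close>

lemma rho_inject:
  assumes "valid x" "valid y" "rho x = rho y"
  shows "x = y"
proof -
  obtain a b c d where x: "qv (fst x) = (a, b, c, d)" by (cases "qv (fst x)")
  obtain a' b' c' d' where y: "qv (fst y) = (a', b', c', d')" by (cases "qv (fst y)")
  have "snd x * of_int (fst (qv (fst x))) = snd y * of_int (fst (qv (fst y)))"
    using qm_trace_eq[of "snd x" a b c d "snd y" a' b' c' d'] assms(3)
    by (simp add: rho_def x y del: qm.simps)
  then have "snd x = snd y"
    using assms(1,2) by (auto simp: qv_real valid_def split: if_splits)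
  then show ?thesis
    using assms by (metis rho_def valid_def qm_inject qv_inject prod_eq_iff)
qed

lemma rho_cj: "rho (a, z) ** rho (b, w) = rho (b, w) ** rho (cj a b, z)"
proof -
  have "qmul (qv a) (qv b) = qmul (qv b) (qv (cj a b))" using qmul_cj by blast
  then show ?thesis by (simp only: rho_def fst_conv snd_conv qm_mult mult.commute[of w z])
qed

lemma rho_right_inverse: "z \<noteq> 0 \<Longrightarrow> rho (c, z) ** qm (1 / z) (qconj (qv c)) = mat 1"
  by (simp add: rho_def qm_conj qv_norm)

lemma rho_invertible: "snd x \<noteq> 0 \<Longrightarrow> invertible (rho x)"
  by (metis rho_right_inverse invertible_right_inverse prod.collapse)

definition quat_mats :: "cmat set" where "quat_mats = {qm z p | z p. z \<noteq> 0 \<and> p \<in> set units}"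

lemma quat_matsI: "z \<noteq> 0 \<Longrightarrow> p \<in> set units \<Longrightarrow> qm z p \<in> quat_mats"
  unfolding quat_mats_def by blast

lemma gens_quat_mats: "{G7_s, G7_t, G7_u} \<subseteq> quat_mats"
proof -
  \<comment> \<open>A primitive cube root of unity; \<open>G7_t\<close> and \<open>G7_u\<close> are
    unit quaternions times this scalar.\<close>
  define z where "z = (-1 - complex_of_real (sqrt 3) * \<i>) / 2"
  have z: "z \<noteq> 0" by (simp add: z_def complex_eq_iff)
  have i: "\<i> * (\<i> * x) = - x" for x by (metis i_squared mult.assoc mult_minus1)
  have s: "G7_s = qm (- \<i>) (0, 2, 0, 0)" by (simp add: G7_s_def mat2_eq_iff)
  have t: "G7_t = qm z (-1, 1, -1, 1)"
    by (simp add: G7_t_def mat2_eq_iff z_def field_simps i)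
  have "G7_u = mat2
     ((1/4) * ((1 + of_real (sqrt 3)) + (-1 + of_real (sqrt 3)) * \<i>))
     ((1/4) * ((-1 + of_real (sqrt 3)) - (1 + of_real (sqrt 3)) * \<i>))
     ((1/4) * ((1 + of_real (sqrt 3)) + (-1 + of_real (sqrt 3)) * \<i>))
     ((1/4) * ((1 - of_real (sqrt 3)) + (1 + of_real (sqrt 3)) * \<i>))"
    by (simp add: G7_u_def G7_t_def mat2_def transpose_def vec_eq_iff forall_2)
  then have u: "G7_u = qm z (-1, 1, 1, 1)"
    by (simp add: mat2_eq_iff z_def field_simps i)
  have "(0, 2, 0, 0) \<in> set units" "(-1, 1, -1, 1) \<in> set units" "(-1, 1, 1, 1) \<in> set units"
    by code_simp+
  then have "qm (- \<i>) (0, 2, 0, 0) \<in> quat_mats" "qm z (-1, 1, -1, 1) \<in> quat_mats"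
      "qm z (-1, 1, 1, 1) \<in> quat_mats"
    using z by (auto intro!: quat_matsI simp del: qm.simps)
  then show ?thesis unfolding s t u by blast
qed

lemma quat_mats_mult:
  assumes "A \<in> quat_mats" "B \<in> quat_mats"
  shows "A ** B \<in> quat_mats"
proof -
  obtain z p w q where *: "A = qm z p" "B = qm w q" "z \<noteq> 0" "w \<noteq> 0" "p \<in> set units" "q \<in> set units"
    using assms by (auto simp: quat_mats_def)
  then obtain a b c d where "(a, b, c, d) \<in> set units" "qmul p q = (2 * a, 2 * b, 2 * c, 2 * d)"
    using units_qmul by fast
  moreover from this have "A ** B = qm (z * w) (a, b, c, d)"
    by (simp only: * qm_mult qm_scale) (simp del: qm.simps)
  ultimately show ?thesis using * unfolding quat_mats_def by force
qed

lemma quat_mats_inv: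
  assumes "A \<in> quat_mats"
  shows "matrix_inv A \<in> quat_mats"
proof -
  obtain z p where *: "A = qm z p" "z \<noteq> 0" "p \<in> set units"
    using assms by (auto simp: quat_mats_def)
  then have "matrix_inv A = qm (1 / z) (qconj p)"
    using units_qconj by (simp add: matrix_inv_eq qm_conj)
  moreover have "qconj p \<in> set units" "1 / z \<noteq> 0" using units_qconj * by auto
  ultimately show ?thesis unfolding quat_mats_def by blast
qed

lemma G7_quat_mats: "A \<in> G7 \<Longrightarrow> A \<in> quat_mats"
  unfolding G7_def
proof (induction rule: gen_grp.induct)
  case one
  have "mat 1 = qm 1 (2, 0, 0, 0)" by (simp add: mat_one_mat2)
  moreover have "(2, 0, 0, 0) \<in> set units" by code_simp
  ultimately show ?case unfolding quat_mats_def by (metis (mono_tags, lifting) mem_Collect_eq one_neq_zero)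
qed (use gens_quat_mats quat_mats_mult quat_mats_inv in auto)

section \<open>Reflections among the scaled quaternions\<close>

lemma reflection_fixes:
  assumes "is_reflection A"
  shows "\<exists>v. v \<noteq> 0 \<and> A *v v = v" "A \<noteq> mat 1"
proof -
  show "\<exists>v. v \<noteq> 0 \<and> A *v v = v"
  proof (rule ccontr)
    assume "\<nexists>v. v \<noteq> 0 \<and> A *v v = v"
    then have "{v. A *v v = v} = {0}" by auto
    then show False using assms by (simp add: is_reflection_def)
  qed
  show "A \<noteq> mat 1"
    using assms vec_dim_card[where 'a = complex and 'n = 2] by (auto simp: is_reflection_def)
qed

text \<open>Eigenvalue 1 forces \<open>det (A - 1) = det A - trace A + 1\<close> to vanish; here the
  determinant is \<open>z\<^sup>2\<close> because the quaternion has norm 1, and the trace is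
  \<open>z * a\<close>.\<close>

lemma reflection_char_poly:
  assumes "is_reflection (qm z (a, b, c, d))" "qnorm (a, b, c, d) = 4"
  shows "z\<^sup>2 - z * of_int a + 1 = 0"
proof -
  define \<alpha> \<beta> \<gamma> \<delta> where abcd: "\<alpha> = z * (of_int a + of_int b * \<i>) / 2" "\<beta> = z * (of_int c + of_int d * \<i>) / 2"
    "\<gamma> = z * (- of_int c + of_int d * \<i>) / 2" "\<delta> = z * (of_int a - of_int b * \<i>) / 2"
  obtain v where v: "v \<noteq> 0" "mat2 \<alpha> \<beta> \<gamma> \<delta> *v v = v"
    using reflection_fixes(1)[OF assms(1)] by (auto simp: abcd)
  have "\<alpha> * v$1 + \<beta> * v$2 = v$1" "\<gamma> * v$1 + \<delta> * v$2 = v$2"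
    using v(2) by (simp_all add: mat2_def matrix_vector_mult_def vec_eq_iff sum_2 forall_2)
  then have "((\<alpha> - 1) * (\<delta> - 1) - \<beta> * \<gamma>) * v$1 = 0" "((\<alpha> - 1) * (\<delta> - 1) - \<beta> * \<gamma>) * v$2 = 0"
  proof -
    assume 1: "\<alpha> * v$1 + \<beta> * v$2 = v$1" and 2: "\<gamma> * v$1 + \<delta> * v$2 = v$2"
    \<comment> \<open>The adjugate of \<open>A - 1\<close> applied to \<open>(A - 1) v = 0\<close>,
      one coordinate at a time.\<close>
    have "((\<alpha> - 1) * (\<delta> - 1) - \<beta> * \<gamma>) * v$1
        = (\<delta> - 1) * (\<alpha> * v$1 + \<beta> * v$2 - v$1) - \<beta> * (\<gamma> * v$1 + \<delta> * v$2 - v$2)"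
      by (simp add: algebra_simps)
    then show "((\<alpha> - 1) * (\<delta> - 1) - \<beta> * \<gamma>) * v$1 = 0" using 1 2 by simp
    have "((\<alpha> - 1) * (\<delta> - 1) - \<beta> * \<gamma>) * v$2
        = (\<alpha> - 1) * (\<gamma> * v$1 + \<delta> * v$2 - v$2) - \<gamma> * (\<alpha> * v$1 + \<beta> * v$2 - v$1)"
      by (simp add: algebra_simps)
    then show "((\<alpha> - 1) * (\<delta> - 1) - \<beta> * \<gamma>) * v$2 = 0" using 1 2 by simp
  qed
  moreover have "v$1 \<noteq> 0 \<or> v$2 \<noteq> 0" using v(1) by (auto simp: vec_eq_iff forall_2)
  ultimately have "(\<alpha> - 1) * (\<delta> - 1) - \<beta> * \<gamma> = 0" by auto
  moreover have "\<alpha> * \<delta> - \<beta> * \<gamma> = z\<^sup>2"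
  proof -
    have norm: "a * a + b * b + c * c + d * d = 4" using assms(2) by simp
    have i: "\<i> * (\<i> * x) = - x" for x by (metis i_squared mult.assoc mult_minus1)
    have "\<alpha> * \<delta> - \<beta> * \<gamma> = z\<^sup>2 * of_int (a * a + b * b + c * c + d * d) / 4"
      by (simp add: abcd power2_eq_square field_simps i)
    then show ?thesis unfolding norm by simp
  qed
  moreover have "\<alpha> + \<delta> = z * of_int a" by (simp add: abcd field_simps)
  ultimately show ?thesis by (simp add: algebra_simps)
qed

lemma reflection_rho:
  assumes "is_reflection A" "A \<in> G7"
  shows "\<exists>x. valid x \<and> A = rho x"
proof -
  obtain z p where *: "A = qm z p" "z \<noteq> 0" "p \<in> set units"
    using G7_quat_mats[OF assms(2)] by (auto simp: quat_mats_def)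
  obtain a b c d where p: "p = (a, b, c, d)" by (cases p)
  have e: "z\<^sup>2 - z * of_int a + 1 = 0"
    using reflection_char_poly assms(1) * p units_qconj by metis
  have tri: "kind x \<noteq> Invol" if "x \<in> set (cores Pos @ cores Neg)" for x
    using that by (auto simp: set_cores)
  have "p \<in> qv ` set (cores Pos @ cores Neg @ cores Invol)
     \<or> (\<exists>x\<in>set (cores Pos @ cores Neg). qv x = (-a, -b, -c, -d)) \<or> p = (2, 0, 0, 0) \<or> p = (-2, 0, 0, 0)"
    using *(3) p by (auto simp: units_def split: prod.splits)
  then have "(\<exists>x. p = qv x) \<or> (\<exists>x. kind x \<noteq> Invol \<and> qv x = (-a, -b, -c, -d))
     \<or> p = (2, 0, 0, 0) \<or> p = (-2, 0, 0, 0)"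
    using tri by blast
  then consider x where "p = qv x" | x where "kind x \<noteq> Invol" "qv x = (-a, -b, -c, -d)"
    | "p = (2, 0, 0, 0)" | "p = (-2, 0, 0, 0)"
    by blast
  then show ?thesis
  proof cases
    case 1
    show ?thesis
    proof (cases "kind x = Invol")
      case True
      then have "a = 0" using qv_real[of x] 1 p by (metis fst_conv)
      \<comment> \<open>For real part 0 the equation is \<open>z\<^sup>2 = -1\<close>; if
        \<open>z = - \<i>\<close>, the sign is moved into the quaternion.\<close>
      then have "z = \<i> \<or> z = - \<i>"
        using e by (metis add.commute add.inverse_inverse add_eq_0_iff diff_zero mult_zero_right of_int_0 power2_eq_iff power2_i)
      then show ?thesis
      proof
        assume "z = \<i>"
        then show ?thesis using 1 * True by (intro exI[of _ "(x, \<i>)"]) (simp add: rho_def valid_def)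
      next
        assume z: "z = - \<i>"
        obtain e s where x: "x = Quad e s" using True by (cases x) (auto split: if_splits)
        have "A = rho (Quad e (\<not> s), \<i>)"
          using 1 * z x by (cases e) (simp_all add: rho_def sg_def mat2_eq_iff)
        then show ?thesis by (intro exI[of _ "(Quad e (\<not> s), \<i>)"]) (simp add: valid_def)
      qed
    next
      case False
      then show ?thesis using 1 * by (intro exI[of _ "(x, z)"]) (simp add: rho_def valid_def)
    qed
  next
    case 2
    then have "A = rho (x, - z)" using * p by (simp add: rho_def qm_uminus del: qm.simps)
    then show ?thesis using 2 * by (intro exI[of _ "(x, - z)"]) (simp add: valid_def)
  next
    case 3
    then have "(z - 1)\<^sup>2 = 0" using e p by (simp add: power2_eq_square algebra_simps)
    then have "A = mat 1" using * 3 by (simp add: mat_one_mat2)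
    then show ?thesis using reflection_fixes(2)[OF assms(1)] by simp
  next
    case 4
    then have "(z + 1)\<^sup>2 = 0" using e p by (simp add: power2_eq_square algebra_simps)
    then have "z = -1" by (simp add: eq_neg_iff_add_eq_0)
    then have "A = mat 1" using * 4 by (simp add: mat_one_mat2)
    then show ?thesis using reflection_fixes(2)[OF assms(1)] by simp
  qed
qed

section \<open>Hurwitz moves on words of pairs\<close>

type_synonym elem = "core \<times> complex"

definition xc :: "elem \<Rightarrow> elem \<Rightarrow> elem" where "xc x y = (cj (fst x) (fst y), snd x)"

inductive hstep :: "elem list \<Rightarrow> elem list \<Rightarrow> bool" where
  "hstep (us @ x # y # vs) (us @ y # xc x y # vs)"

abbreviation heq :: "elem list \<Rightarrow> elem list \<Rightarrow> bool" where "heq \<equiv> hstep\<^sup>*\<^sup>*"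

lemma hstep_append: "hstep A B \<Longrightarrow> hstep (us @ A @ vs) (us @ B @ vs)"
proof (induction rule: hstep.induct)
  case (1 us' x y vs')
  show ?case using hstep.intros[of "us @ us'" x y "vs' @ vs"] by simp
qed

lemma heq_append: "heq A B \<Longrightarrow> heq (us @ A @ vs) (us @ B @ vs)"
  by (induction rule: rtranclp_induct) (auto intro: hstep_append rtranclp.rtrancl_into_rtrancl)

lemma heq_Cons: "heq A B \<Longrightarrow> heq (x # A) (x # B)"
  using heq_append[of A B "[x]" "[]"] by simp

lemma heq_tw:
  assumes "tw (a, b) = (a', b')"
  shows "heq (us @ (a, z) # (b, w) # vs) (us @ (a', z) # (b', w) # vs)"
proof -
  have "hstep (us @ (a, z) # (b, w) # vs) (us @ (b, w) # (cj a b, z) # vs)"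
    using hstep.intros[of us "(a, z)" "(b, w)" vs] by (simp add: xc_def)
  moreover have "hstep (us @ (b, w) # (cj a b, z) # vs) (us @ (a', z) # (b', w) # vs)"
    using hstep.intros[of us "(b, w)" "(cj a b, z)" vs] assms by (auto simp: xc_def Let_def)
  ultimately show ?thesis by (meson converse_rtranclp_into_rtranclp r_into_rtranclp)
qed

lemma heq_tw_funpow:
  assumes "(tw ^^ n) (a, b) = (a', b')"
  shows "heq (us @ (a, z) # (b, w) # vs) (us @ (a', z) # (b', w) # vs)"
  using assms
proof (induction n arbitrary: a' b')
  case (Suc n)
  obtain c d where cd: "(tw ^^ n) (a, b) = (c, d)" by fastforce
  with Suc.prems have "tw (c, d) = (a', b')" by simp
  from Suc.IH[OF cd] heq_tw[OF this] show ?case by (meson rtranclp_trans)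
qed simp

text \<open>One more move at the same position completes a twist, and five further twists complete
  the period.\<close>

lemma hstep_sym: "hstep A B \<Longrightarrow> heq B A"
proof (induction rule: hstep.induct)
  case (1 us x y vs)
  obtain a z b w where xy: "x = (a, z)" "y = (b, w)" by (meson surj_pair)
  obtain a' b' where ab: "tw (a, b) = (a', b')" by fastforce
  have "hstep (us @ y # xc x y # vs) (us @ (a', z) # (b', w) # vs)"
    using hstep.intros[of us y "xc x y" vs] ab by (auto simp: xc_def xy Let_def)
  moreover have "(tw ^^ 5) (a', b') = (a, b)"
    using tw_period[rule_format, of a b] ab by (simp add: numeral_eq_Suc)
  then have "heq (us @ (a', z) # (b', w) # vs) (us @ x # y # vs)"
    unfolding xy by (rule heq_tw_funpow)
  ultimately show ?case by (rule converse_rtranclp_into_rtranclp)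
qed

lemma heq_sym: "heq A B \<Longrightarrow> heq B A"
  by (induction rule: rtranclp_induct) (auto dest: hstep_sym intro: rtranclp_trans)

lemma heq_bring: "heq (us @ x # vs) (x # map (\<lambda>y. xc y x) us @ vs)"
proof (induction us)
  case (Cons u us)
  have "heq (u # us @ x # vs) (u # x # map (\<lambda>y. xc y x) us @ vs)"
    using heq_Cons[OF Cons.IH] by simp
  moreover have "hstep (u # x # map (\<lambda>y. xc y x) us @ vs) (x # xc u x # map (\<lambda>y. xc y x) us @ vs)"
    using hstep.intros[of "[]" u x] by simp
  ultimately show ?case by simp
qed simp

text \<open>The alphabet \<open>D\<close> makes room for functions such as the axis, which
  conjugation by order 3 elements does not preserve.\<close>

definition invariant_on :: "elem set \<Rightarrow> (elem \<Rightarrow> 'k) \<Rightarrow> bool" where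
  "invariant_on D f \<longleftrightarrow> (\<forall>x\<in>D. \<forall>y\<in>D. xc x y \<in> D \<and> f (xc x y) = f x)"

lemma hstep_invariant:
  assumes "hstep A B" "invariant_on D f" "set A \<subseteq> D"
  shows "set B \<subseteq> D" "mset (map f B) = mset (map f A)"
  using assms by (auto simp: invariant_on_def elim!: hstep.cases)

lemma heq_invariant:
  assumes "heq A B" "invariant_on D f" "set A \<subseteq> D"
  shows "set B \<subseteq> D \<and> mset (map f B) = mset (map f A)"
  using assms(1)
proof (induction rule: rtranclp_induct)
  case (step B C)
  then show ?case using hstep_invariant[OF step.hyps(2) assms(2)] by auto
qed (use assms in simp)

text \<open>An entry with the next prescribed value is brought to the front; the entries it passes
  are conjugated, which does not change their values.\<close>

lemma heq_reorder:
  assumes "invariant_on D f" "set A \<subseteq> D" "mset (map f A) = mset ks"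
  shows "\<exists>B. heq A B \<and> map f B = ks"
  using assms(2,3)
proof (induction ks arbitrary: A)
  case (Cons k ks)
  then have "k \<in> set (map f A)" by (metis list.set_intros(1) mset_eq_setD)
  then obtain us x vs where A: "A = us @ x # vs" and k: "k = f x"
    by (auto dest: split_list)
  let ?R = "map (\<lambda>y. xc y x) us @ vs"
  have h: "heq A (x # ?R)" unfolding A by (rule heq_bring)
  have "set (x # ?R) \<subseteq> D \<and> mset (map f (x # ?R)) = mset (k # ks)"
    using heq_invariant[OF h assms(1) Cons.prems(1)] Cons.prems(2) by simp
  then have "set ?R \<subseteq> D" "mset (map f ?R) = mset ks" by (simp_all add: k)
  then obtain B where B: "heq ?R B" "map f B = ks" using Cons.IH by blast
  have "heq A (x # B)" by (rule rtranclp_trans[OF h heq_Cons[OF B(1)]])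
  moreover have "map f (x # B) = k # ks" using B(2) k by simp
  ultimately show ?case by (intro exI[of _ "x # B"] conjI)
qed simp

abbreviation kd :: "elem \<Rightarrow> species" where "kd x \<equiv> kind (fst x)"

lemma invariant_kd: "invariant_on UNIV kd"
  by (simp add: invariant_on_def xc_def kind_cj)

lemma invariant_kd_snd: "invariant_on UNIV (\<lambda>x. (kd x, snd x))"
  by (simp add: invariant_on_def xc_def kind_cj)

lemma heq_kd: "heq A B \<Longrightarrow> mset (map kd B) = mset (map kd A)"
  using heq_invariant[OF _ invariant_kd] by simp

lemma heq_length: "heq A B \<Longrightarrow> length B = length A"
  using heq_kd by (metis length_map size_mset)

lemma heq_snd: "heq A B \<Longrightarrow> snd ` set B = snd ` set A"
  using heq_invariant[of A B UNIV snd]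
  by (metis (no_types, lifting) invariant_on_def iso_tuple_UNIV_I list.set_map mset_eq_setD snd_conv
      subset_UNIV xc_def)

lemma heq_pull:
  assumes "y \<in> set R"
  shows "\<exists>R'. heq (P @ R) (P @ y # R') \<and> mset (map kd R) = add_mset (kd y) (mset (map kd R'))"
proof -
  obtain us vs where "R = us @ y # vs" using assms by (auto dest: split_list)
  then have "heq R (y # map (\<lambda>u. xc u y) us @ vs)" using heq_bring by blast
  then show ?thesis
    using heq_append[of R _ P "[]"] heq_kd[of R] by (metis append_Nil2 list.simps(9) mset.simps(2))
qed

lemma noncomm_set: "set cs = set ds \<Longrightarrow> noncomm cs \<longleftrightarrow> noncomm ds"
  by (simp add: noncomm_def)

lemma hstep_noncomm:
  assumes "hstep A B"
  shows "noncomm (map fst B) \<longleftrightarrow> noncomm (map fst A)"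
  using assms
proof (induction rule: hstep.induct)
  case (1 us x y vs)
  let ?A = "map fst (us @ x # y # vs)" and ?B = "map fst (us @ y # xc x y # vs)"
  \<comment> \<open>If either word is commutative, \<open>x\<close> and \<open>y\<close> commute and
    the move merely transposes them, so the set of entries stays the same.\<close>
  have *: "set ?A = set ?B" if "cj (fst x) (fst y) = fst x"
    using that by (auto simp: xc_def)
  have "cj (fst x) (fst y) = fst x" if "\<not> noncomm ?A"
    using that by (auto simp: noncomm_def comm_def)
  moreover have "cj (fst x) (fst y) = fst x" if "\<not> noncomm ?B"
    using that comm_cj_same by (auto simp: noncomm_def xc_def)
  ultimately show ?case using noncomm_set[OF *] by blast
qed

lemma heq_noncomm: "heq A B \<Longrightarrow> noncomm (map fst B) \<longleftrightarrow> noncomm (map fst A)"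
  by (induction rule: rtranclp_induct) (auto simp: hstep_noncomm)

lemma good_alt: "good (map fst T) \<longleftrightarrow> noncomm (map fst T) \<and> (\<exists>k\<in>#mset (map kd T). k \<noteq> Invol)"
  by (auto simp: good_def)

lemma heq_good: "heq A B \<Longrightarrow> good (map fst B) \<longleftrightarrow> good (map fst A)"
  unfolding good_alt by (metis heq_kd heq_noncomm)

lemma noncomm_mono: "set cs \<subseteq> set ds \<Longrightarrow> noncomm cs \<Longrightarrow> noncomm ds"
  by (auto simp: noncomm_def)

lemma good_mono: "set cs \<subseteq> set ds \<Longrightarrow> good cs \<Longrightarrow> good ds"
  using noncomm_mono by (auto simp: good_def)

text \<open>Otherwise all entries would commute with \<open>a\<close>, hence with each other by
  \<open>comm_trans\<close>.\<close>

lemma noncomm_partner: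
  assumes "noncomm cs" "a \<in> set cs" "kind a \<noteq> Invol"
  shows "\<exists>b\<in>set cs. \<not> comm a b"
proof (rule ccontr)
  assume "\<not> (\<exists>b\<in>set cs. \<not> comm a b)"
  then have "comm b c" if "b \<in> set cs" "c \<in> set cs" for b c
    using that assms(3) comm_trans comm_sym by blast
  then show False using assms(1) by (auto simp: noncomm_def)
qed

lemma length_twist [simp]: "length (twist i cs) = length cs"
  by (induction i cs rule: twist.induct) (auto simp: Let_def)

lemma length_twists [simp]: "length (twists w cs) = length cs"
  by (induction w arbitrary: cs) auto

lemma heq_twist:
  "length zs = length cs \<Longrightarrow> heq (zip cs zs) (zip (twist i cs) zs)"
proof (induction i cs arbitrary: zs rule: twist.induct)
  case (1 a b r)
  then obtain z w zs' where "zs = z # w # zs'" by (auto simp: length_Suc_conv)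
  moreover have "tw (a, b) = (cj a b, cj b (cj a b))" by (simp add: Let_def)
  ultimately show ?case
    using heq_tw[of a b _ _ "[]" z w "zip r zs'"] by (simp add: Let_def)
next
  case (2 i a r)
  then obtain z zs' where "zs = z # zs'" "length zs' = length r" by (auto simp: length_Suc_conv)
  then show ?case using 2 heq_Cons by simp
qed auto

lemma heq_twists:
  "length zs = length cs \<Longrightarrow> heq (zip cs zs @ R) (zip (twists w cs) zs @ R)"
proof (induction w arbitrary: cs)
  case (Cons i w)
  have "heq (zip cs zs @ R) (zip (twist i cs) zs @ R)"
    using heq_append[OF heq_twist[OF Cons.prems], of "[]"] by simp
  then show ?case using Cons.IH[of "twist i cs"] Cons.prems by simp
qed simp

text \<open>The exception \<open>s\<close> may depend on the word, whereas \<open>k\<close> and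
  \<open>z\<close> will be the same for both words under comparison.\<close>

definition detachable :: "elem list \<Rightarrow> species \<Rightarrow> complex \<Rightarrow> bool" where
  "detachable T k z \<longleftrightarrow>
     (\<exists>s. \<forall>r. kind r = k \<longrightarrow> r \<noteq> s \<longrightarrow> (\<exists>T'. heq T ((r, z) # T') \<and> good (map fst T')))"

text \<open>Only the block \<open>X\<close> is braided. Its new tail need not be \<open>good\<close>
  alone, but together with the untouched rest \<open>R\<close>.\<close>

lemma detachable_spread:
  assumes "heq T (X @ R)" "X = (c, z) # X'" "spread ws P (map fst X)"
    and "\<And>t. P t \<Longrightarrow> length t = length X' \<Longrightarrow> good (t @ map fst R)"
  shows "detachable T (kind c) z"
proof -
  obtain s where s: "\<forall>r\<in>set (cores (kind c)). r = s \<or>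
      (\<exists>w\<in>set ws. hd (twists w (map fst X)) = r \<and> P (tl (twists w (map fst X))))"
    using assms(3) unfolding spread_def assms(2) by (auto simp: Let_def)
  have "\<exists>T'. heq T ((r, z) # T') \<and> good (map fst T')" if "kind r = kind c" "r \<noteq> s" for r
  proof -
    obtain w where w: "hd (twists w (map fst X)) = r" "P (tl (twists w (map fst X)))"
      using s \<open>r \<noteq> s\<close> \<open>kind r = kind c\<close> by (auto simp: set_cores)
    define t where "t = tl (twists w (map fst X))"
    have "length (twists w (map fst X)) = Suc (length X')" by (simp add: assms(2))
    then have t: "twists w (map fst X) = r # t" "length t = length X'"
      using w(1) unfolding t_def by (metis length_Suc_conv list.sel(1,3))+
    have Pt: "P t" unfolding t_def by (rule w(2))
    have X: "heq (X @ R) (zip (r # t) (map snd X) @ R)"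
      using heq_twists[of "map snd X" "map fst X" R w] t by (simp add: zip_map_fst_snd)
    have "heq T ((r, z) # zip t (map snd X') @ R)"
      using rtranclp_trans[OF assms(1) X] by (simp add: assms(2))
    moreover have "good (map fst (zip t (map snd X') @ R))"
      using assms(4)[OF Pt t(2)] t(2) by simp
    ultimately show ?thesis by blast
  qed
  then show ?thesis unfolding detachable_def by blast
qed

section \<open>Splitting off the first entry\<close>

lemma comm_refl: "comm a a"
  by (cases a) (auto simp: comm_def)

lemma heq_pull_kind:
  assumes "l \<in># mset (map kd R)"
  shows "\<exists>y R'. kd y = l \<and> heq (P @ R) (P @ y # R') \<and> mset (map kd R) = add_mset l (mset (map kd R'))"
proof -
  obtain y where "y \<in> set R" "kd y = l" using assms by auto
  then show ?thesis using heq_pull[of y R P] by blast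
qed

lemma good_mixed:
  assumes "Invol \<in> kind ` set cs" "l \<in> kind ` set cs" "l \<noteq> Invol"
  shows "good cs"
proof -
  obtain a b where ab: "a \<in> set cs" "b \<in> set cs" "kind a = Invol" "kind b = l"
    using assms(1,2) by (metis imageE)
  then have "\<not> comm a b" using comm_kind[rule_format, of a b] assms(3) by auto
  then show ?thesis using ab assms(3) unfolding good_def noncomm_def by blast
qed

lemma species_not_Invol: "k \<noteq> Invol \<Longrightarrow> k \<in> {Pos, Neg}"
  by (cases k) auto

text \<open>What remains is \<open>good\<close> for free: it contains elements of order 3 and of
  order 4, and these never commute.\<close>

lemma detach_Tri:
  assumes "(c, z) \<in> set T" "kind c \<noteq> Invol" "Invol \<in># mset (map kd T) - {#kind c#}"
    "l \<in># mset (map kd T) - {#kind c#}" "l \<noteq> Invol"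
  shows "detachable T (kind c) z"
proof -
  obtain T1 where T1: "heq T ((c, z) # T1)" "mset (map kd T) = add_mset (kind c) (mset (map kd T1))"
    using heq_pull[OF assms(1), of "[]"] by auto
  obtain s T2 where s: "kd s = Invol" "heq ((c, z) # T1) ((c, z) # s # T2)"
      "mset (map kd T1) = add_mset Invol (mset (map kd T2))"
    using heq_pull_kind[of Invol T1 "[(c, z)]"] assms(3) T1(2) by auto
  have l: "l \<in> kind ` set (map fst T2)"
  proof -
    have "l \<in># mset (map kd T2)" using assms(4,5) T1(2) s(3) by simp
    then show ?thesis by auto
  qed
  have "spread [[], [0], [0, 0]] (\<lambda>t. map kind t = [Invol]) [c, fst s]"
    using spread_Tri_Quad species_not_Invol[OF assms(2)] s(1) set_cores by blast
  then have sp: "spread [[], [0], [0, 0]] (\<lambda>t. map kind t = [Invol]) (map fst [(c, z), s])" by simp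
  have h: "heq T ([(c, z), s] @ T2)" using rtranclp_trans[OF T1(1) s(2)] by simp
  have "good (t @ map fst T2)" if "map kind t = [Invol]" for t
    by (rule good_mixed[OF _ _ assms(5)]) (use that l in auto)
  then show ?thesis by (rule detachable_spread[OF h refl sp])
qed

text \<open>Serves words with a single order 3 element, which must not be split off. The block puts
  it between two order 4 elements.\<close>

lemma detach_Quad:
  assumes "(c, z) \<in> set T" "kind c = Invol" "Invol \<in># mset (map kd T) - {#Invol#}"
    "l \<in># mset (map kd T)" "l \<noteq> Invol"
  shows "detachable T Invol z"
proof -
  obtain T1 where T1: "heq T ((c, z) # T1)" "mset (map kd T) = add_mset (kind c) (mset (map kd T1))"
    using heq_pull[OF assms(1), of "[]"] by auto
  have "l \<in># mset (map kd T1)" using assms(2,4,5) unfolding T1(2) by auto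
  then obtain p T2 where p: "kd p = l" "heq ((c, z) # T1) ((c, z) # p # T2)"
      "mset (map kd T1) = add_mset l (mset (map kd T2))"
    using heq_pull_kind[of l T1 "[(c, z)]"] by auto
  have "Invol \<in># mset (map kd T2)" using assms(2,3,5) unfolding T1(2) p(3) by auto
  then obtain s T3 where s: "kd s = Invol" "heq ((c, z) # p # T2) ((c, z) # p # s # T3)"
    using heq_pull_kind[of Invol T2 "[(c, z), p]"] by auto
  have h: "heq T ([(c, z), p, s] @ T3)"
    using rtranclp_trans[OF T1(1) rtranclp_trans[OF p(2) s(2)]] by simp
  obtain ws where "spread ws good [c, fst p, fst s]"
    using spread_Quad_Tri_Quad species_not_Invol[OF assms(5)] assms(2) p(1) s(1) set_cores by blast
  then have "spread ws good (map fst [(c, z), p, s])" by simp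
  from detachable_spread[OF h refl this] show ?thesis
    using assms(2) good_mono[of _ "_ @ map fst T3"] by (metis Un_upper1 set_append)
qed

lemma detach_mixed:
  assumes "good (map fst T)" "(c, z) \<in> set T" "kind c \<noteq> Invol"
    "kind c \<in># mset (map kd T) - {#kind c#}" "Invol \<notin># mset (map kd T)"
    "l \<in># mset (map kd T)" "l \<noteq> kind c"
  shows "detachable T (kind c) z"
proof -
  define k where "k = kind c"
  have kl: "(k, l) \<in> {(Pos, Neg), (Neg, Pos)}"
    using assms(3,5,6,7) unfolding k_def by (cases "kind c"; cases l) auto
  have others: "m = k \<or> m = l" if "m \<in># mset (map kd T)" for m
    using that kl assms(5) by (cases m) auto
  obtain T1 where T1: "heq T ((c, z) # T1)" "mset (map kd T) = add_mset k (mset (map kd T1))"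
    using heq_pull[OF assms(2), of "[]"] by (auto simp: k_def)
  have "noncomm (map fst ((c, z) # T1))"
    using heq_good[OF T1(1)] assms(1) by (simp add: good_def)
  then obtain y where y: "y \<in> set T1" "\<not> comm c (fst y)"
    using noncomm_partner[of _ c] assms(3) comm_refl by fastforce
  obtain T2 where T2: "heq ((c, z) # T1) ((c, z) # y # T2)"
      "mset (map kd T1) = add_mset (kd y) (mset (map kd T2))"
    using heq_pull[OF y(1), of "[(c, z)]"] by auto
  \<comment> \<open>The species still missing from the pattern \<open>k\<close>, \<open>k\<close>,
    \<open>l\<close> of \<open>spread_mixed\<close>, up to order.\<close>
  define m where "m = (if kd y = k then l else k)"
  have "k \<in># mset (map kd T1)" using assms(4) T1(2) by (simp add: k_def)
  moreover have "l \<in># mset (map kd T1)" using assms(6,7) unfolding T1(2) by (auto simp: k_def)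
  ultimately have "m \<in># mset (map kd T2)"
    unfolding T2(2) using kl by (auto simp: m_def split: if_splits)
  then obtain v T3 where v: "kd v = m" "heq ((c, z) # y # T2) ((c, z) # y # v # T3)"
    using heq_pull_kind[of m T2 "[(c, z), y]"] by auto
  have h: "heq T ((c, z) # y # v # T3)"
    by (rule rtranclp_trans[OF T1(1) rtranclp_trans[OF T2(1) v(2)]])
  have nc: "noncomm (map fst [(c, z), y, v])" using y(2) by (auto simp: noncomm_def)
  obtain p w where pw: "kd p = k" "kd w = l" "heq T ([(c, z), p, w] @ T3)"
      "noncomm (map fst [(c, z), p, w])"
  proof (cases "kd y = k")
    case True
    then show ?thesis using that[of y v] v(1) h nc by (simp add: m_def)
  next
    case False
    have "kd y = l" using others[of "kd y"] False unfolding T1(2) T2(2) by auto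
    \<comment> \<open>The last two entries are in the wrong order; one move exchanges them,
      conjugating \<open>y\<close>.\<close>
    have "hstep [(c, z), y, v] [(c, z), v, xc y v]" using hstep.intros[of "[(c, z)]" y v "[]"] by simp
    then have "noncomm (map fst [(c, z), v, xc y v])" using hstep_noncomm nc by blast
    moreover have "hstep ((c, z) # y # v # T3) ([(c, z), v, xc y v] @ T3)"
      using hstep.intros[of "[(c, z)]" y v T3] by simp
    then have "heq T ([(c, z), v, xc y v] @ T3)" by (rule rtranclp.rtrancl_into_rtrancl[OF h])
    ultimately show ?thesis
      using that[of v "xc y v"] False v(1) \<open>kd y = l\<close> by (simp add: m_def xc_def kind_cj)
  qed
  have "c \<in> set (cores k)" "fst p \<in> set (cores k)" "fst w \<in> set (cores l)"
    using pw by (simp_all add: set_cores k_def)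
  then obtain ws where "spread ws good [c, fst p, fst w]"
    using spread_mixed kl pw(4) by (fastforce split: if_splits)
  then have "spread ws good (map fst [(c, z), p, w])" by simp
  from detachable_spread[OF pw(3) refl this] show ?thesis
    using good_mono[of _ "_ @ map fst T3"] by (metis Un_upper1 set_append)
qed

lemma detach_uniform:
  assumes "good (map fst T)" "(c, z) \<in> set T" "\<And>x. x \<in> set T \<Longrightarrow> kd x = kind c" "length T \<ge> 4"
  shows "detachable T (kind c) z"
proof -
  define k where "k = kind c"
  have k: "k \<in> {Pos, Neg}"
    using assms(1,3) species_not_Invol by (auto simp: good_def k_def)
  obtain T1 where T1: "heq T ((c, z) # T1)" using heq_pull[OF assms(2), of "[]"] by auto
  have "noncomm (map fst ((c, z) # T1))"
    using heq_good[OF T1(1)] assms(1) by (simp add: good_def)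
  then obtain y where y: "y \<in> set T1" "\<not> comm c (fst y)"
    using noncomm_partner[of _ c] k comm_refl by (fastforce simp: k_def)
  obtain T2 where T2: "heq ((c, z) # T1) ((c, z) # y # T2)"
    using heq_pull[OF y(1), of "[(c, z)]"] by auto
  have h: "heq T ((c, z) # y # T2)" by (rule rtranclp_trans[OF T1 T2])
  then have "length T2 \<ge> 2" using heq_length assms(4) by fastforce
  then obtain v w T3 where T3: "T2 = v # w # T3"
    by (metis Suc_le_length_iff numeral_2_eq_2)
  have "kd x = k" if "x \<in> set [(c, z), y, v, w]" for x
  proof -
    have "kd ` set T = kd ` set ((c, z) # y # T2)"
      using heq_kd[OF h] by (metis list.set_map mset_eq_setD)
    then have "kd x \<in> kd ` set T" using that T3 by auto
    then show ?thesis using assms(3) by (auto simp: k_def)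
  qed
  then have "fst y \<in> set (cores k)" "fst v \<in> set (cores k)" "fst w \<in> set (cores k)" "c \<in> set (cores k)"
    by (simp_all add: set_cores k_def)
  moreover have "noncomm [c, fst y, fst v, fst w]" using y(2) by (auto simp: noncomm_def)
  ultimately obtain ws where "spread ws good [c, fst y, fst v, fst w]"
    using spread_uniform[rule_format, OF k, of c "fst y" "fst v" "fst w"] by auto
  then have "spread ws good (map fst [(c, z), y, v, w])" by simp
  moreover have "heq T ([(c, z), y, v, w] @ T3)" using h T3 by simp
  ultimately show ?thesis
    using detachable_spread[OF _ refl] good_mono[of _ "_ @ map fst T3"] by (metis Un_upper1 set_append)
qed

section \<open>Products, and words of length 2 and 3\<close>

lemma mat_prod_list_append: "mat_prod_list (A @ B) = mat_prod_list A ** mat_prod_list B"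
  by (induction A) (simp_all add: mat_prod_list_def matrix_mul_assoc)

lemma mat_prod_list_Cons: "mat_prod_list (a # A) = a ** mat_prod_list A"
  by (simp add: mat_prod_list_def)

lemma rho_xc: "rho x ** rho y = rho y ** rho (xc x y)"
  using rho_cj[of "fst x" "snd x" "fst y" "snd y"] by (simp add: xc_def)

lemma heq_prod: "heq A B \<Longrightarrow> mat_prod_list (map rho B) = mat_prod_list (map rho A)"
proof (induction rule: rtranclp_induct)
  case (step B C)
  from step.hyps(2) have "mat_prod_list (map rho C) = mat_prod_list (map rho B)"
  proof cases
    case (1 us x y vs)
    have swap: "rho x ** (rho y ** M) = rho y ** (rho (xc x y) ** M)" for M
      by (simp only: matrix_mul_assoc rho_xc[of x y])
    show ?thesis by (simp add: 1 mat_prod_list_append mat_prod_list_Cons flip: swap)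
  qed
  then show ?case using step.IH by simp
qed simp

lemma rho_left_cancel: "snd x \<noteq> 0 \<Longrightarrow> rho x ** A = rho x ** B \<Longrightarrow> A = B"
  by (metis matrix_inv_both(2) matrix_mul_assoc matrix_mul_lid rho_invertible)

text \<open>Collects what the induction needs about tails: the common head cancels from the product,
  and its value from the multiset.\<close>

lemma heq_same_head:
  assumes "heq T (x # T')" "heq V (x # V')" "mat_prod_list (map rho T) = mat_prod_list (map rho V)"
    "0 \<notin> snd ` set T" "mset (map f T) = mset (map f V)" "invariant_on D f" "set T \<subseteq> D" "set V \<subseteq> D"
  shows "mat_prod_list (map rho T') = mat_prod_list (map rho V')" "0 \<notin> snd ` set T'"
    "mset (map f T') = mset (map f V')" "length T = Suc (length T')" "set T' \<subseteq> D" "set V' \<subseteq> D"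
proof -
  have nz: "0 \<notin> snd ` set (x # T')" using heq_snd[OF assms(1)] assms(4) by simp
  then show "0 \<notin> snd ` set T'" by simp
  show "mat_prod_list (map rho T') = mat_prod_list (map rho V')"
    using heq_prod[OF assms(1)] heq_prod[OF assms(2)] assms(3) nz
      rho_left_cancel[of x "mat_prod_list (map rho T')" "mat_prod_list (map rho V')"]
    by (simp add: mat_prod_list_Cons)
  show "set T' \<subseteq> D" "set V' \<subseteq> D"
    using heq_invariant[OF assms(1,6,7)] heq_invariant[OF assms(2,6,8)] by auto
  have "add_mset (f x) (mset (map f T')) = add_mset (f x) (mset (map f V'))"
    using heq_invariant[OF assms(1,6,7)] heq_invariant[OF assms(2,6,8)] assms(5)
    by (metis list.simps(9) mset.simps(2))
  then show "mset (map f T') = mset (map f V')" by simp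
  show "length T = Suc (length T')" using heq_length[OF assms(1)] by simp
qed

lemma prod_pair_eq:
  assumes "mat_prod_list (map rho [(a, z), (b, w)]) = mat_prod_list (map rho [(c, z), (d, w)])"
    "z \<noteq> 0" "w \<noteq> 0"
  shows "qmul (qv a) (qv b) = qmul (qv c) (qv d)"
proof -
  have "qm (z * w / 2) (qmul (qv a) (qv b)) = qm (z * w / 2) (qmul (qv c) (qv d))"
    using assms(1) by (simp add: mat_prod_list_def rho_def qm_mult del: qm.simps)
  then show ?thesis using qm_inject[of "z * w / 2"] assms by simp
qed

lemma prod_triple_eq:
  assumes "mat_prod_list (map rho [(a, z), (b, w), (c, y)]) = mat_prod_list (map rho [(a', z), (b', w), (c', y)])"
    "z \<noteq> 0" "w \<noteq> 0" "y \<noteq> 0"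
  shows "qmul (qmul (qv a) (qv b)) (qv c) = qmul (qmul (qv a') (qv b')) (qv c')"
proof -
  have "qm (z * w / 2 * y / 2) (qmul (qmul (qv a) (qv b)) (qv c))
      = qm (z * w / 2 * y / 2) (qmul (qmul (qv a') (qv b')) (qv c'))"
  proof -
    have "qm z (qv a) ** qm w (qv b) ** qm y (qv c) = qm z (qv a') ** qm w (qv b') ** qm y (qv c')"
      using assms(1) by (simp add: mat_prod_list_def rho_def matrix_mul_assoc del: qm.simps)
    then show ?thesis by (simp only: qm_mult)
  qed
  then show ?thesis using qm_inject[of "z * w / 2 * y / 2"] assms by simp
qed

lemma heq_twists_list:
  assumes "twists w (map fst T) = map fst V" "map snd T = map snd V"
  shows "heq T V"
proof -
  have "length (map snd T) = length (map fst T)" by simp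
  from heq_twists[OF this, of "[]" w] show ?thesis
    unfolding assms(1) append_Nil2 zip_map_fst_snd by (simp only: assms(2) zip_map_fst_snd)
qed

lemma good_length:
  assumes "good (map fst T)"
  shows "length T \<ge> 2"
proof (cases T)
  case (Cons x R)
  then show ?thesis using assms comm_refl by (cases R) (auto simp: good_def noncomm_def)
qed (use assms in \<open>simp add: good_def\<close>)

text \<open>A trace of the conjugacy class that does not refer to the generated subgroup, so it
  still makes sense for tails.\<close>

definition cls :: "elem \<Rightarrow> species \<times> complex" where "cls x = (kd x, snd x)"

lemma invariant_cls: "invariant_on UNIV cls"
  using invariant_kd_snd by (simp add: cls_def[abs_def])

lemma mset_cls_kd: "mset (map cls T) = mset (map cls V) \<Longrightarrow> mset (map kd T) = mset (map kd V)"
proof -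
  assume "mset (map cls T) = mset (map cls V)"
  then have "image_mset fst (mset (map cls T)) = image_mset fst (mset (map cls V))" by simp
  then show ?thesis by (simp add: image_mset.compositionality comp_def cls_def)
qed

lemma equiv_pair:
  assumes "good (map fst T)" "good (map fst V)" "0 \<notin> snd ` set T"
    "mset (map cls T) = mset (map cls V)"
    "mat_prod_list (map rho T) = mat_prod_list (map rho V)" "length T = 2"
  shows "heq T V"
proof -
  obtain x y where T: "T = [x, y]" using assms(6) by (auto simp: numeral_2_eq_2 length_Suc_conv)
  \<comment> \<open>\<open>pair_orbit\<close> needs an element of order 3 in front. Both words are
    brought to this one order, which also aligns their scalars.\<close>
  define ks where "ks = (if kd x = Invol then [cls y, cls x] else [cls x, cls y])"
  have ks: "mset (map cls T) = mset ks" by (simp add: T ks_def)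
  obtain A where A: "heq T A" "map cls A = ks"
    using heq_reorder[OF invariant_cls _ ks] by auto
  obtain B where B: "heq V B" "map cls B = ks"
    using heq_reorder[OF invariant_cls, of V ks] ks assms(4) by auto
  have gA: "good (map fst A)" and gB: "good (map fst B)"
    using heq_good A(1) B(1) assms(1,2) by blast+
  have "kd (if kd x = Invol then y else x) \<noteq> Invol" using assms(1) by (auto simp: good_def T)
  then obtain k l z w where ks': "ks = [(k, z), (l, w)]" "k \<noteq> Invol"
    by (auto simp: ks_def cls_def split: if_splits)
  obtain a b where a: "A = [(a, z), (b, w)]" "kind a = k" "kind b = l"
    using A(2) unfolding ks'(1) cls_def by (auto simp: map_eq_Cons_conv)
  obtain c d where c: "B = [(c, z), (d, w)]" "kind c = k" "kind d = l"
    using B(2) unfolding ks'(1) cls_def by (auto simp: map_eq_Cons_conv)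
  have nz: "z \<noteq> 0" "w \<noteq> 0" using heq_snd[OF A(1)] assms(3) unfolding a by auto
  have "mat_prod_list (map rho A) = mat_prod_list (map rho B)"
    using heq_prod A(1) B(1) assms(5) by metis
  then have q: "qmul (qv a) (qv b) = qmul (qv c) (qv d)"
    using prod_pair_eq nz unfolding a(1) c(1) by blast
  have "\<not> comm a b"
    using noncomm_partner[of "[a, b]" a] gA ks'(2) comm_refl by (auto simp: good_def a)
  moreover have "l \<in> {Pos, Neg, Invol}" by (cases l) auto
  moreover have "a \<in> set (cores k)" "b \<in> set (cores l)" "c \<in> set (cores k)" "d \<in> set (cores l)"
    by (simp_all add: set_cores a c)
  ultimately have "\<exists>u\<in>{[], [0], [0, 0]}. twists u [a, b] = [c, d]"
    using pair_orbit species_not_Invol[OF ks'(2)] q by presburger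
  then obtain u where "twists u [a, b] = [c, d]" by blast
  then have "heq A B" by (intro heq_twists_list[of u]) (simp_all add: a c)
  then show ?thesis using A(1) heq_sym[OF B(1)] by (meson rtranclp_trans)
qed

lemma equiv_triple:
  assumes "good (map fst T)" "good (map fst V)" "0 \<notin> snd ` set T"
    "mset (map cls T) = mset (map cls V)"
    "mat_prod_list (map rho T) = mat_prod_list (map rho V)" "length T = 3"
    "\<And>x. x \<in> set T \<Longrightarrow> kd x = k" "k \<noteq> Invol"
  shows "heq T V"
proof -
  obtain x1 x2 x3 where T0: "T = [x1, x2, x3]" using assms(6) by (auto simp: numeral_3_eq_3 length_Suc_conv)
  obtain a z b w c y where T: "T = [(a, z), (b, w), (c, y)]"
    unfolding T0 by (metis surj_pair)
  obtain B where B: "heq V B" "map cls B = map cls T"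
    using heq_reorder[OF invariant_cls, of V "map cls T"] assms(4) by auto
  obtain a' b' c' where V: "B = [(a', z), (b', w), (c', y)]"
      "kind a' = kind a" "kind b' = kind b" "kind c' = kind c"
    using B(2) unfolding T cls_def by (auto simp: map_eq_Cons_conv)
  have nz: "z \<noteq> 0" "w \<noteq> 0" "y \<noteq> 0" using assms(3) by (auto simp: T)
  have "mat_prod_list (map rho T) = mat_prod_list (map rho B)"
    using heq_prod B(1) assms(5) by metis
  then have "qmul (qmul (qv a) (qv b)) (qv c) = qmul (qmul (qv a') (qv b')) (qv c')"
    using prod_triple_eq nz unfolding T V(1) by blast
  moreover have "kind a = k" "kind b = k" "kind c = k"
    using assms(7)[of "(a, z)"] assms(7)[of "(b, w)"] assms(7)[of "(c, y)"] by (simp_all add: T)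
  then have "a \<in> set (cores k)" "b \<in> set (cores k)" "c \<in> set (cores k)"
      "a' \<in> set (cores k)" "b' \<in> set (cores k)" "c' \<in> set (cores k)"
    using V by (simp_all add: set_cores)
  moreover have "noncomm [a, b, c]" using assms(1) by (simp add: good_def T)
  ultimately have "\<exists>u. twists u [a, b, c] = [a', b', c']"
    using triple_orbit species_not_Invol[OF assms(8)] by meson
  then obtain u where "twists u [a, b, c] = [a', b', c']" by blast
  then have "heq T B" by (intro heq_twists_list[of u]) (simp_all add: T V)
  then show ?thesis using heq_sym[OF B(1)] by (rule rtranclp_trans)
qed

text \<open>Two exceptions cannot exhaust a class of four or six quaternions.\<close>

lemma detachable_common:
  assumes "detachable T k z" "detachable V k z"
  shows "\<exists>r T' V'. heq T (r # T') \<and> heq V (r # V') \<and> good (map fst T') \<and> good (map fst V')"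
proof -
  obtain s where s: "\<And>r. kind r = k \<Longrightarrow> r \<noteq> s \<Longrightarrow> \<exists>T'. heq T ((r, z) # T') \<and> good (map fst T')"
    using assms(1) by (auto simp: detachable_def)
  obtain t where t: "\<And>r. kind r = k \<Longrightarrow> r \<noteq> t \<Longrightarrow> \<exists>T'. heq V ((r, z) # T') \<and> good (map fst T')"
    using assms(2) by (auto simp: detachable_def)
  have "card (set (cores k)) \<ge> 4" by (cases k) (auto simp: cores_def)
  then have "\<not> set (cores k) \<subseteq> {s, t}"
    using card_mono[of "{s, t}" "set (cores k)"] by (auto simp: card_insert_if split: if_splits)
  then obtain r where "kind r = k" "r \<noteq> s" "r \<noteq> t"
    by (metis insertCI set_cores subsetI)
  then show ?thesis using s t by metis
qed

text \<open>The choice of \<open>x\<close> rests on data shared by all words with the same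
  \<open>cls\<close> values, so the same species and scalar can be split off from both words under
  comparison.\<close>

lemma detach_or_uniform:
  assumes "good (map fst T)" "length T \<ge> 3"
  obtains "length T = 3" "\<And>x. x \<in> set T \<Longrightarrow> kd x = kd (hd T)" "kd (hd T) \<noteq> Invol"
  | x where "x \<in> set T" "\<And>V. good (map fst V) \<Longrightarrow> mset (map cls V) = mset (map cls T)
      \<Longrightarrow> detachable V (kd x) (snd x)"
proof -
  define M where "M = mset (map kd T)"
  have kdV: "mset (map kd V) = M" if "mset (map cls V) = mset (map cls T)" for V
    using mset_cls_kd[OF that] by (simp add: M_def)
  have member: "\<exists>c. kind c = kd x \<and> (c, snd x) \<in> set V"
    if "x \<in> set T" "mset (map cls V) = mset (map cls T)" for x V
  proof -
    have "cls x \<in> set (map cls V)" using that by (metis image_eqI list.set_map mset_eq_setD)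
    then show ?thesis by (auto simp: cls_def)
  qed
  have size: "size M \<ge> 3" using assms(2) by (simp add: M_def)
  obtain l where l: "l \<in># M" "l \<noteq> Invol" using assms(1) by (auto simp: good_def M_def)
  then obtain x where x: "x \<in> set T" "kd x = l" by (auto simp: M_def)
  show thesis
  proof (cases "Invol \<in># M")
    case True
    show ?thesis
    proof (cases "\<exists>m\<in>#M - {#l#}. m \<noteq> Invol")
      case m: True
      then obtain m where "m \<in># M - {#l#}" "m \<noteq> Invol" by blast
      moreover have "Invol \<in># M - {#l#}" using True l(2) by (simp add: in_diff_count)
      ultimately have "detachable V (kd x) (snd x)" if "mset (map cls V) = mset (map cls T)" for V
        using member[OF x(1) that] kdV[OF that] detach_Tri[of _ "snd x" V m] l x(2) by metis
      then show ?thesis using that(2) x(1) by blast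
    next
      case False
      obtain y where y: "y \<in> set T" "kd y = Invol" using True by (auto simp: M_def)
      \<comment> \<open>Exactly one of at least three entries has order 3, so two have order
        4.\<close>
      have "Invol \<in># M - {#Invol#}"
      proof (rule ccontr)
        assume *: "Invol \<notin># M - {#Invol#}"
        have "Invol \<notin># M - {#l#} - {#Invol#}" using * by (metis diff_right_commute in_diffD)
        moreover have "m = Invol" if "m \<in># M - {#l#} - {#Invol#}" for m
          using that False by (meson in_diffD)
        ultimately have "M - {#l#} - {#Invol#} = {#}" by (metis multiset_nonemptyE)
        moreover have "size (M - {#l#} - {#Invol#}) \<ge> 1"
          using size diff_size_le_size_Diff[of M "{#l#}"] diff_size_le_size_Diff[of "M - {#l#}" "{#Invol#}"] by simp
        ultimately show False by simp
      qed
      then have "detachable V (kd y) (snd y)" if "mset (map cls V) = mset (map cls T)" for V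
        using member[OF y(1) that] kdV[OF that] detach_Quad[of _ "snd y" V l] l y(2) by metis
      then show ?thesis using that(2) y(1) by blast
    qed
  next
    case False
    show ?thesis
    proof (cases "\<exists>m\<in>#M. m \<noteq> l")
      case True
      then obtain m where m: "m \<in># M" "m \<noteq> l" by blast
      have lm: "n = l \<or> n = m" if "n \<in># M" for n
        using that m l False by (cases n; cases l; cases m) auto
      \<comment> \<open>Pigeonhole: at least three entries and only the two species \<open>l\<close>
        and \<open>m\<close>.\<close>
      obtain k k' where k: "k \<in># M - {#k#}" "k \<in># M" "k' \<in># M" "k' \<noteq> k"
      proof -
        have "size (M - {#l#} - {#m#}) \<ge> 1"
          using size diff_size_le_size_Diff[of M "{#l#}"] diff_size_le_size_Diff[of "M - {#l#}" "{#m#}"] by simp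
        then obtain n where n: "n \<in># M - {#l#} - {#m#}" by (metis multiset_nonemptyE not_one_le_zero size_empty)
        then have "n = l \<or> n = m" using lm by (meson in_diffD)
        then show ?thesis
        proof
          assume "n = l"
          then show ?thesis using that[of l m] n m l(1) by (metis diff_right_commute in_diffD)
        next
          assume "n = m"
          then show ?thesis using that[of m l] n m l(1) by (metis diff_right_commute in_diffD)
        qed
      qed
      obtain y where y: "y \<in> set T" "kd y = k" using k(2) by (auto simp: M_def)
      have "k \<noteq> Invol" using k(2) False by auto
      then have "detachable V (kd y) (snd y)" if "good (map fst V)" "mset (map cls V) = mset (map cls T)" for V
        using member[OF y(1) that(2)] kdV[OF that(2)] detach_mixed[of V _ "snd y" k'] k False y(2) that(1) by metis
      then show ?thesis using that(2) y(1) by blast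
    next
      case uniform: False
      have kl: "kd y = l" if "mset (map cls V) = mset (map cls T)" "y \<in> set V" for V y
        using kdV[OF that(1)] that(2) uniform by (metis image_eqI list.set_map set_mset_mset)
      show ?thesis
      proof (cases "length T = 3")
        case True
        then have "hd T \<in> set T" by (cases T) auto
        then show ?thesis using that(1) True kl[OF refl] l(2) by metis
      next
        case False
        have "detachable V (kd x) (snd x)" if V: "good (map fst V)" "mset (map cls V) = mset (map cls T)" for V
        proof -
          obtain c where c: "kind c = kd x" "(c, snd x) \<in> set V" using member[OF x(1) V(2)] by blast
          have "length V = length T" using V(2) by (metis length_map size_mset)
          then show ?thesis using detach_uniform[OF V(1) c(2)] kl[OF V(2)] c(1) x(2) False assms(2) by auto
        qed
        then show ?thesis using that(2) x(1) by blast
      qed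
    qed
  qed
qed

lemma good_heq:
  assumes "good (map fst T)" "good (map fst V)" "0 \<notin> snd ` set T"
    "mset (map cls T) = mset (map cls V)"
    "mat_prod_list (map rho T) = mat_prod_list (map rho V)"
  shows "heq T V"
  using assms
proof (induction "length T" arbitrary: T V rule: less_induct)
  case less
  show ?case
  proof (cases "length T = 2")
    case True
    then show ?thesis using equiv_pair less.prems by blast
  next
    case False
    then have "length T \<ge> 3" using good_length[OF less.prems(1)] by simp
    with less.prems(1) show ?thesis
    proof (cases rule: detach_or_uniform)
      case 1
      then show ?thesis using equiv_triple less.prems by blast
    next
      case (2 x)
      then have "detachable T (kd x) (snd x)" "detachable V (kd x) (snd x)"
        using less.prems by auto
      then obtain r T' V' where r: "heq T (r # T')" "heq V (r # V')"
          "good (map fst T')" "good (map fst V')"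
        using detachable_common by blast
      note same = heq_same_head[OF r(1,2) less.prems(5,3,4) invariant_cls subset_UNIV subset_UNIV]
      have "heq T' V'" using less.hyps[of T' V'] r(3,4) same by simp
      then have "heq (r # T') (r # V')" by (rule heq_Cons)
      then show ?thesis using r(1) heq_sym[OF r(2)] by (meson rtranclp_trans)
    qed
  qed
qed

section \<open>Words of order 4 elements only\<close>

definition ax :: "elem \<Rightarrow> axis \<times> complex" where "ax x = (axis_of (fst x), snd x)"

abbreviation Invols :: "elem set" where "Invols \<equiv> {x. kd x = Invol}"

lemma invariant_ax: "invariant_on Invols ax"
  using axis_cj by (auto simp: invariant_on_def xc_def ax_def kind_cj set_cores)

lemma comm_axis: "kind a = Invol \<Longrightarrow> kind b = Invol \<Longrightarrow> comm a b \<longleftrightarrow> axis_of a = axis_of b"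
  using comm_Invol[rule_format, of a b] by (simp add: set_cores)

lemma noncomm_ax:
  assumes "set T \<subseteq> Invols" "e \<in># mset (map (fst \<circ> ax) T)" "f \<in># mset (map (fst \<circ> ax) T)" "e \<noteq> f"
  shows "noncomm (map fst T)"
proof -
  obtain x y where xy: "x \<in> set T" "y \<in> set T" "axis_of (fst x) = e" "axis_of (fst y) = f"
    using assms(2,3) by (auto simp: ax_def)
  then have "\<not> comm (fst x) (fst y)"
    using comm_axis[of "fst x" "fst y"] assms(1,4) by auto
  then show ?thesis using xy by (auto simp: noncomm_def)
qed

lemma ax_noncomm:
  assumes "set T \<subseteq> Invols" "noncomm (map fst T)"
  shows "\<exists>e f. e \<in># mset (map (fst \<circ> ax) T) \<and> f \<in># mset (map (fst \<circ> ax) T) \<and> e \<noteq> f"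
proof -
  obtain x y where xy: "x \<in> set T" "y \<in> set T" "\<not> comm (fst x) (fst y)"
    using assms(2) by (auto simp: noncomm_def)
  then have "axis_of (fst x) \<noteq> axis_of (fst y)"
    using comm_axis[of "fst x" "fst y"] assms(1) by auto
  then show ?thesis using xy by (intro exI[of _ "axis_of (fst x)"] exI[of _ "axis_of (fst y)"]) (auto simp: ax_def)
qed

lemma mset_ax_axis: "mset (map ax T) = mset (map ax V) \<Longrightarrow> mset (map (fst \<circ> ax) T) = mset (map (fst \<circ> ax) V)"
  by (metis list.map_comp mset_map)

text \<open>A twist with a neighbour on another axis flips the sign of \<open>x\<close>, so both
  quaternions on its axis are reached without exception. The axes in the tail do not change, and two
  distinct ones are left.\<close>

lemma detach_ax:
  assumes T: "set T \<subseteq> Invols" "x \<in> set T"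
    and ef: "e \<in># mset (map (fst \<circ> ax) T) - {#fst (ax x)#}" "f \<in># mset (map (fst \<circ> ax) T) - {#fst (ax x)#}" "e \<noteq> f"
    and r: "kind r = Invol" "axis_of r = axis_of (fst x)"
  shows "\<exists>T'. heq T ((r, snd x) # T') \<and> noncomm (map fst T')"
proof -
  have inv: "set B \<subseteq> Invols \<and> mset (map (fst \<circ> ax) B) = mset (map (fst \<circ> ax) A)"
    if "heq A B" "set A \<subseteq> Invols" for A B
    using heq_invariant[OF that(1) invariant_ax that(2)] mset_ax_axis by blast
  obtain T1 where T1: "heq T (x # T1)"
    using heq_pull[OF T(2), of "[]"] by auto
  note 1 = inv[OF T1 T(1)]
  have ef1: "e \<in># mset (map (fst \<circ> ax) T1)" "f \<in># mset (map (fst \<circ> ax) T1)"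
    using ef 1 by (metis add_mset_remove_trivial comp_apply list.simps(9) mset.simps(2))+
  have "\<exists>g \<in># mset (map (fst \<circ> ax) T1). g \<noteq> axis_of (fst x)" using ef1 ef(3) by metis
  then obtain y where y: "y \<in> set T1" "axis_of (fst y) \<noteq> axis_of (fst x)"
    by (auto simp: ax_def)
  obtain T2 where T2: "heq (x # T1) (x # y # T2)"
    using heq_pull[OF y(1), of "[x]"] by auto
  have h: "heq T (x # y # T2)" by (rule rtranclp_trans[OF T1 T2])
  note 2 = inv[OF h T(1)]
  have "\<exists>w\<in>{[], [0]}. hd (twists w [fst x, fst y]) = r \<and>
      map axis_of (tl (twists w [fst x, fst y])) = [axis_of (fst y)]"
  proof -
    have "fst x \<in> set (cores Invol)" "fst y \<in> set (cores Invol)" "r \<in> set (cores Invol)"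
      using 2 r(1) by (simp_all add: set_cores)
    note twist = bspec[OF bspec[OF bspec[OF twist_Invol this(1)] this(2)] this(3)]
    have "\<not> (axis_of (fst x) = axis_of (fst y) \<or> axis_of r \<noteq> axis_of (fst x))"
      using r(2) y(2) by simp
    then show ?thesis using twist by (simp only: if_False)
  qed
  then obtain w where w: "hd (twists w [fst x, fst y]) = r"
      "map axis_of (tl (twists w [fst x, fst y])) = [axis_of (fst y)]" by (elim bexE conjE)
  moreover have "length (twists w [fst x, fst y]) = 2" by simp
  ultimately obtain c where c: "twists w [fst x, fst y] = [r, c]" "axis_of c = axis_of (fst y)"
    by (cases "twists w [fst x, fst y]") auto
  have "heq (x # y # T2) ((r, snd x) # (c, snd y) # T2)"
    using heq_twists[of "[snd x, snd y]" "[fst x, fst y]" T2 w] c(1) by simp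
  then have h': "heq T ((r, snd x) # (c, snd y) # T2)" by (rule rtranclp_trans[OF h])
  note 3 = inv[OF h' T(1)]
  have "mset (map (fst \<circ> ax) ((c, snd y) # T2)) = mset (map (fst \<circ> ax) T1)"
  proof -
    have "add_mset (fst (ax x)) (mset (map (fst \<circ> ax) (y # T2)))
        = add_mset (fst (ax x)) (mset (map (fst \<circ> ax) T1))"
      using conjunct2[OF 1] conjunct2[OF 2] by (metis comp_apply list.simps(9) mset.simps(2))
    then show ?thesis by (simp add: ax_def c(2))
  qed
  then have "noncomm (map fst ((c, snd y) # T2))"
    using noncomm_ax[of "(c, snd y) # T2" e f] ef1 ef(3) 3 by simp
  then show ?thesis using h' by blast
qed

lemma noncomm_length: "noncomm cs \<Longrightarrow> length cs \<ge> 2"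
  using comm_refl by (cases cs; cases "tl cs") (auto simp: noncomm_def)

lemma equiv_pair_Invol:
  assumes "set T \<subseteq> Invols" "set V \<subseteq> Invols" "noncomm (map fst T)" "0 \<notin> snd ` set T"
    "mset (map ax T) = mset (map ax V)"
    "mat_prod_list (map rho T) = mat_prod_list (map rho V)" "length T = 2"
  shows "heq T V"
proof -
  obtain a z b w where T: "T = [(a, z), (b, w)]"
    using assms(7) by (auto simp: numeral_2_eq_2 length_Suc_conv)
  obtain B where B: "heq V B" "map ax B = map ax T"
    using heq_reorder[OF invariant_ax assms(2), of "map ax T"] assms(5) by auto
  obtain c d where V: "B = [(c, z), (d, w)]" "axis_of c = axis_of a" "axis_of d = axis_of b"
    using B(2) unfolding T ax_def by (auto simp: map_eq_Cons_conv)
  have "set B \<subseteq> Invols" using heq_invariant[OF B(1) invariant_ax assms(2)] by simp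
  then have "c \<in> set (cores Invol)" "d \<in> set (cores Invol)" by (simp_all add: V set_cores)
  moreover have "a \<in> set (cores Invol)" "b \<in> set (cores Invol)"
    using assms(1) by (simp_all add: T set_cores)
  moreover have "axis_of a \<noteq> axis_of b"
    using ax_noncomm[OF assms(1,3)] by (auto simp: T ax_def)
  moreover have "mat_prod_list (map rho T) = mat_prod_list (map rho B)"
    using heq_prod[OF B(1)] assms(6) by simp
  then have "qmul (qv a) (qv b) = qmul (qv c) (qv d)"
    using prod_pair_eq assms(4) unfolding T V(1) by auto
  ultimately have "\<exists>w\<in>{[], [0]}. twists w [a, b] = [c, d]"
    using pair_Invol V(2,3) by presburger
  then obtain u where "twists u [a, b] = [c, d]" by blast
  then have "heq T B" by (intro heq_twists_list[of u]) (simp_all add: T V)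
  then show ?thesis using heq_sym[OF B(1)] by (rule rtranclp_trans)
qed

lemma Invol_heq:
  assumes "set T \<subseteq> Invols" "set V \<subseteq> Invols" "noncomm (map fst T)" "0 \<notin> snd ` set T"
    "mset (map ax T) = mset (map ax V)"
    "mat_prod_list (map rho T) = mat_prod_list (map rho V)"
  shows "heq T V"
  using assms
proof (induction "length T" arbitrary: T V rule: less_induct)
  case less
  show ?case
  proof (cases "length T = 2")
    case True
    then show ?thesis using equiv_pair_Invol less.prems by blast
  next
    case False
    define M where "M = mset (map (fst \<circ> ax) T)"
    have MV: "M = mset (map (fst \<circ> ax) V)" unfolding M_def by (rule mset_ax_axis) (rule less.prems)
    obtain e f where ef: "e \<in># M" "f \<in># M" "e \<noteq> f"
      using ax_noncomm[OF less.prems(1,3)] by (auto simp: M_def)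
    have "size M \<ge> 3" using noncomm_length[OF less.prems(3)] False by (simp add: M_def)
    then have "size (M - {#e#} - {#f#}) \<ge> 1"
      using diff_size_le_size_Diff[of M "{#e#}"] diff_size_le_size_Diff[of "M - {#e#}" "{#f#}"] by simp
    \<comment> \<open>The axis of a third entry. It may coincide with \<open>e\<close> or
      \<open>f\<close>, yet both are still present after its removal.\<close>
    then obtain g where g: "g \<in># M - {#e#} - {#f#}"
      by (metis multiset_nonemptyE not_one_le_zero size_empty)
    have g_ef: "e \<in># M - {#g#}" "f \<in># M - {#g#}" "g \<in># M"
    proof -
      obtain N where "M = add_mset e (add_mset f (add_mset g N))"
        using g ef by (metis in_diffD insert_DiffM insert_noteq_member multi_member_split)
      then show "e \<in># M - {#g#}" "f \<in># M - {#g#}" "g \<in># M" using ef by auto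
    qed
    obtain x where x: "x \<in> set T" "fst (ax x) = g" using g_ef(3) by (auto simp: M_def)
    have "ax x \<in> set (map ax V)" using x(1) less.prems(5) by (metis image_eqI list.set_map mset_eq_setD)
    then obtain y where y: "y \<in> set V" "ax y = ax x" by auto
    have xy: "snd y = snd x" "axis_of (fst y) = axis_of (fst x)" using y(2) by (simp_all add: ax_def)
    have "kind (fst x) = Invol" using less.prems(1) x(1) by auto
    then obtain T' V' where r: "heq T (x # T')" "noncomm (map fst T')"
        "heq V (x # V')" "noncomm (map fst V')"
      using detach_ax[OF less.prems(1) x(1), of e f "fst x"] detach_ax[OF less.prems(2) y(1), of e f "fst x"]
        g_ef ef(3) x(2) y(2) xy MV M_def by (metis prod.collapse)
    note same = heq_same_head[OF r(1,3) less.prems(6,4,5) invariant_ax less.prems(1,2)]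
    have "heq T' V'" using less.hyps[of T' V'] r(2) same by simp
    then have "heq (x # T') (x # V')" by (rule heq_Cons)
    then show ?thesis using r(1) heq_sym[OF r(3)] by (meson rtranclp_trans)
  qed
qed

section \<open>Transfer to matrix factorizations\<close>

lemma gen_grp_invertible:
  assumes "h \<in> gen_grp S" "\<And>x. x \<in> S \<Longrightarrow> invertible x"
  shows "invertible h"
  using assms(1)
proof induction
  case one
  show ?case by (auto simp: invertible_def intro: exI[of _ "mat 1"])
qed (use assms(2) invertible_mult matrix_inv_both in blast)+

lemma gen_grp_mono: "S \<subseteq> gen_grp S' \<Longrightarrow> gen_grp S \<subseteq> gen_grp S'"
proof
  fix x assume "S \<subseteq> gen_grp S'" "x \<in> gen_grp S"
  from this(2,1) show "x \<in> gen_grp S'" by induction (auto intro: gen_grp.intros)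
qed

lemma gen_grp_commute:
  assumes "h \<in> gen_grp S" "\<And>x. x \<in> S \<Longrightarrow> invertible x" "\<And>x. x \<in> S \<Longrightarrow> x ** c = c ** x"
  shows "h ** c = c ** h"
  using assms(1)
proof induction
  case (mul x y)
  then show ?case by (metis matrix_mul_assoc)
next
  case (inv x)
  have "invertible x" using gen_grp_invertible inv.hyps assms(2) by blast
  then show ?case
    using inv.IH matrix_inv_both(1,2) by (metis matrix_mul_assoc matrix_mul_lid matrix_mul_rid)
qed (simp_all add: assms(3))

lemma gen_grp_abelian:
  assumes "\<And>x. x \<in> S \<Longrightarrow> invertible x" "\<And>x y. x \<in> S \<Longrightarrow> y \<in> S \<Longrightarrow> x ** y = y ** x"
    "g \<in> gen_grp S" "h \<in> gen_grp S"
  shows "g ** h = h ** g"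
proof (rule gen_grp_commute[OF assms(3,1)])
  fix x assume "x \<in> S"
  then show "x ** h = h ** x" using gen_grp_commute[OF assms(4,1), of x] assms(2) by metis
qed

lemma hurwitz_step_iff:
  "hurwitz_step T T' \<longleftrightarrow>
     (\<exists>us x y vs. T = us @ x # y # vs \<and> T' = us @ y # (matrix_inv y ** x ** y) # vs)"
proof
  assume "hurwitz_step T T'"
  then obtain i where i: "i + 1 < length T" "T' = hurwitz_move i T" by (auto simp: hurwitz_step_def)
  define us x y vs where "us = take i T" and "x = T ! i" and "y = T ! (i + 1)" and "vs = drop (i + 2) T"
  have T: "T = us @ x # y # vs" and len: "length us = i"
    using i(1) by (simp_all add: us_def x_def y_def vs_def Cons_nth_drop_Suc)
  have "T' = us @ y # (matrix_inv y ** x ** y) # vs"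
    unfolding i(2) hurwitz_move_def unfolding T using len by (simp add: nth_append list_update_append)
  then show "\<exists>us x y vs. T = us @ x # y # vs \<and> T' = us @ y # (matrix_inv y ** x ** y) # vs"
    using T by blast
next
  assume "\<exists>us x y vs. T = us @ x # y # vs \<and> T' = us @ y # (matrix_inv y ** x ** y) # vs"
  then obtain us x y vs where "T = us @ x # y # vs" "T' = us @ y # (matrix_inv y ** x ** y) # vs" by blast
  then show "hurwitz_step T T'"
    unfolding hurwitz_step_def hurwitz_move_def
    by (intro exI[of _ "length us"]) (simp add: nth_append list_update_append)
qed

text \<open>The conjugator \<open>h\<close> on the left corresponds to \<open>y ** h\<close> on the
  right, and \<open>h\<close> on the right to \<open>matrix_inv y ** h\<close> on the left.\<close>

lemma conj_class_conj:
  assumes "y \<in> H" "H = gen_grp S" "\<And>x. x \<in> S \<Longrightarrow> invertible x"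
  shows "conj_class H (matrix_inv y ** x ** y) = conj_class H x"
proof -
  have inv: "invertible h" if "h \<in> H" for h using gen_grp_invertible assms(2,3) that by blast
  have invm: "matrix_inv (a ** b) = matrix_inv b ** matrix_inv a" if "a \<in> H" "b \<in> H" for a b
    by (rule matrix_inv_eq) (metis inv that matrix_inv_both(1) matrix_mul_assoc matrix_mul_rid)
  have invi: "matrix_inv (matrix_inv y) = y"
    by (rule matrix_inv_eq) (rule matrix_inv_both(2)[OF inv[OF assms(1)]])
  have "matrix_inv h ** (matrix_inv y ** x ** y) ** h = matrix_inv (y ** h) ** x ** (y ** h)" if "h \<in> H" for h
    using invm[OF assms(1) that] by (simp add: matrix_mul_assoc)
  moreover have "matrix_inv h ** x ** h
      = matrix_inv (matrix_inv y ** h) ** (matrix_inv y ** x ** y) ** (matrix_inv y ** h)" if "h \<in> H" for h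
  proof -
    have "matrix_inv (matrix_inv y ** h) = matrix_inv h ** y"
      using invm[of "matrix_inv y" h] assms(1,2) that invi gen_grp.inv by metis
    then have "matrix_inv (matrix_inv y ** h) ** (matrix_inv y ** x ** y) ** (matrix_inv y ** h)
        = matrix_inv h ** (y ** matrix_inv y) ** x ** (y ** matrix_inv y) ** h"
      by (simp only: matrix_mul_assoc)
    then show ?thesis using matrix_inv_both(1)[OF inv[OF assms(1)]] by simp
  qed
  moreover have "y ** h \<in> H" "matrix_inv y ** h \<in> H" if "h \<in> H" for h
    using that assms(1,2) gen_grp.mul gen_grp.inv by blast+
  ultimately show ?thesis unfolding conj_class_def by blast
qed

lemma hurwitz_step_invariants:
  assumes "hurwitz_step T T'" "\<And>x. x \<in> set T \<Longrightarrow> invertible x"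
  shows "mat_prod_list T' = mat_prod_list T \<and> gen_grp (set T') = gen_grp (set T)
     \<and> conj_class_mset T' = conj_class_mset T \<and> (\<forall>x\<in>set T'. invertible x)"
proof -
  obtain us x y vs where T: "T = us @ x # y # vs" and T': "T' = us @ y # (matrix_inv y ** x ** y) # vs"
    using assms(1) hurwitz_step_iff by blast
  have y: "y ** matrix_inv y = mat 1" "invertible (matrix_inv y)" using assms(2) matrix_inv_both by (auto simp: T)
  define c where "c = matrix_inv y ** x ** y"
  have yc: "y ** c = x ** y" unfolding c_def by (metis y(1) matrix_mul_assoc matrix_mul_lid)
  have swap: "y ** (c ** M) = x ** (y ** M)" for M by (simp only: matrix_mul_assoc yc)
  have 1: "mat_prod_list T' = mat_prod_list T"
    by (simp add: T T' mat_prod_list_append mat_prod_list_Cons flip: c_def swap)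
  have "c \<in> gen_grp (set T)" unfolding c_def T by (intro gen_grp.mul gen_grp.inv gen_grp.gen) auto
  then have "set T' \<subseteq> gen_grp (set T)" by (auto simp: T T' c_def intro: gen_grp.gen)
  \<comment> \<open>This element is \<open>x\<close>, recovered from \<open>y\<close> and its
    conjugate \<open>c\<close>.\<close>
  moreover have "y ** c ** matrix_inv y \<in> gen_grp (set T')"
    unfolding T' c_def[symmetric] by (intro gen_grp.mul gen_grp.inv gen_grp.gen) auto
  then have "x \<in> gen_grp (set T')" by (metis yc y(1) matrix_mul_assoc matrix_mul_rid)
  then have "set T \<subseteq> gen_grp (set T')" by (auto simp: T T' intro: gen_grp.gen)
  ultimately have 2: "gen_grp (set T') = gen_grp (set T)" using gen_grp_mono by blast
  have "conj_class (gen_grp (set T)) c = conj_class (gen_grp (set T)) x"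
    unfolding c_def by (rule conj_class_conj[OF _ refl assms(2)]) (auto simp: T intro: gen_grp.gen)
  then have 3: "conj_class_mset T' = conj_class_mset T"
    unfolding conj_class_mset_def 2 unfolding T T' c_def[symmetric] by simp
  have "invertible c" unfolding c_def
    using y(2) assms(2) by (intro invertible_mult) (auto simp: T)
  then show ?thesis using 1 2 3 assms(2) by (auto simp: T T' c_def)
qed

lemma hurwitz_equiv_invariants:
  assumes "hurwitz_equiv T V" "\<And>x. x \<in> set T \<Longrightarrow> invertible x"
  shows "mat_prod_list V = mat_prod_list T \<and> gen_grp (set V) = gen_grp (set T)
     \<and> conj_class_mset V = conj_class_mset T \<and> (\<forall>x\<in>set V. invertible x)"
  using assms(1) unfolding hurwitz_equiv_def
proof (induction rule: rtranclp_induct)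
  case (step U W)
  then show ?case using hurwitz_step_invariants[OF step.hyps(2)] by auto
qed (use assms(2) in simp)

lemma rho_conj: "snd y \<noteq> 0 \<Longrightarrow> matrix_inv (rho y) ** rho x ** rho y = rho (xc x y)"
  by (metis matrix_inv_both(2) matrix_mul_assoc matrix_mul_lid rho_invertible rho_xc)

lemma hstep_hurwitz:
  assumes "hstep X Y" "0 \<notin> snd ` set X"
  shows "hurwitz_step (map rho X) (map rho Y)"
  using assms
proof cases
  case (1 us x y vs)
  then have "snd y \<noteq> 0" using assms(2) by force
  then have "rho (xc x y) = matrix_inv (rho y) ** rho x ** rho y" by (simp add: rho_conj)
  then show ?thesis unfolding hurwitz_step_iff 1 by auto
qed

lemma heq_hurwitz:
  assumes "heq X Y" "0 \<notin> snd ` set X"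
  shows "hurwitz_equiv (map rho X) (map rho Y)"
  using assms(1) unfolding hurwitz_equiv_def
proof (induction rule: rtranclp_induct)
  case (step U W)
  then have "0 \<notin> snd ` set U" using assms(2) heq_snd by metis
  then show ?case using step hstep_hurwitz by (meson rtranclp.rtrancl_into_rtrancl)
qed simp

section \<open>Conjugacy in the generated subgroup\<close>

lemma rho_conj_inverse:
  assumes "invariant_on D f" "x \<in> D" "b \<in> D" "snd b \<noteq> 0"
  shows "\<exists>y\<in>D. rho b ** rho x ** matrix_inv (rho b) = rho y \<and> f y = f x"
proof -
  \<comment> \<open>Six conjugations by \<open>b\<close> are the identity, so five of them invert
    one.\<close>
  define y where "y = ((\<lambda>u. xc u b) ^^ 5) x"
  have "((\<lambda>u. xc u b) ^^ n) x \<in> D \<and> f (((\<lambda>u. xc u b) ^^ n) x) = f x" for n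
    using assms(1-3) by (induction n) (auto simp: invariant_on_def)
  then have y: "y \<in> D" "f y = f x" by (simp_all add: y_def)
  have "xc y b = x"
  proof -
    have "((\<lambda>u. xc u b) ^^ n) x = (((\<lambda>a. cj a (fst b)) ^^ n) (fst x), snd x)" for n
      by (induction n) (simp_all add: xc_def)
    then have "((\<lambda>u. xc u b) ^^ 6) x = x" using cj_period by simp
    moreover have "((\<lambda>u. xc u b) ^^ 6) x = xc y b" by (simp add: y_def numeral_eq_Suc)
    ultimately show ?thesis by simp
  qed
  then have "rho y ** rho b = rho b ** rho x" using rho_xc by metis
  then have "rho b ** rho x ** matrix_inv (rho b) = rho y"
    by (metis assms(4) matrix_inv_both(1) matrix_mul_assoc matrix_mul_rid rho_invertible)
  then show ?thesis using y by blast
qed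

text \<open>Conjugation by \<open>h\<close> and by its inverse are treated together because the
  \<open>inv\<close> rule exchanges them.\<close>

lemma gen_grp_conj:
  assumes "h \<in> gen_grp (rho ` B)" "B \<subseteq> D" "invariant_on D f" "\<And>x. x \<in> D \<Longrightarrow> snd x \<noteq> 0"
  shows "\<forall>x\<in>D. (\<exists>y\<in>D. matrix_inv h ** rho x ** h = rho y \<and> f y = f x)
     \<and> (\<exists>y\<in>D. h ** rho x ** matrix_inv h = rho y \<and> f y = f x)"
  using assms(1)
proof induction
  case one
  have "matrix_inv (mat 1) = (mat 1 :: cmat)" by (rule matrix_inv_eq) simp
  then show ?case by auto
next
  case (gen g)
  then obtain b where b: "b \<in> B" "g = rho b" by blast
  have "b \<in> D" using b(1) assms(2) by blast
  then have "snd b \<noteq> 0" by (rule assms(4))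
  then have "\<exists>y\<in>D. rho b ** rho x ** matrix_inv (rho b) = rho y \<and> f y = f x" if "x \<in> D" for x
    using rho_conj_inverse[OF assms(3) that] \<open>b \<in> D\<close> by blast
  moreover have "\<exists>y\<in>D. matrix_inv (rho b) ** rho x ** rho b = rho y \<and> f y = f x" if "x \<in> D" for x
    using assms(3) that \<open>b \<in> D\<close> \<open>snd b \<noteq> 0\<close> by (intro bexI[of _ "xc x b"]) (auto simp: rho_conj invariant_on_def)
  ultimately show ?case unfolding b(2) by blast
next
  case (mul g h)
  have inv: "invertible h" if "h \<in> gen_grp (rho ` B)" for h
    by (rule gen_grp_invertible[OF that]) (use assms(2,4) rho_invertible in auto)
  have gh: "matrix_inv (g ** h) = matrix_inv h ** matrix_inv g"
    by (rule matrix_inv_eq) (metis inv mul.hyps matrix_inv_both(1) matrix_mul_assoc matrix_mul_rid)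
  have e: "matrix_inv (g ** h) ** M ** (g ** h) = matrix_inv h ** (matrix_inv g ** M ** g) ** h"
       "(g ** h) ** M ** matrix_inv (g ** h) = g ** (h ** M ** matrix_inv h) ** matrix_inv g" for M
    by (simp_all add: gh matrix_mul_assoc)
  show ?case
  proof (intro ballI conjI)
    fix x assume x: "x \<in> D"
    obtain y where y: "y \<in> D" "matrix_inv g ** rho x ** g = rho y" "f y = f x"
      using mul.IH(1) x by blast
    obtain z where "z \<in> D" "matrix_inv h ** rho y ** h = rho z" "f z = f y"
      using mul.IH(2) y(1) by blast
    then show "\<exists>y\<in>D. matrix_inv (g ** h) ** rho x ** (g ** h) = rho y \<and> f y = f x"
      unfolding e y(2) y(3)[symmetric] by (intro bexI[of _ z] conjI)
    obtain y' where y': "y' \<in> D" "h ** rho x ** matrix_inv h = rho y'" "f y' = f x"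
      using mul.IH(2) x by blast
    obtain z' where "z' \<in> D" "g ** rho y' ** matrix_inv g = rho z'" "f z' = f y'"
      using mul.IH(1) y'(1) by blast
    then show "\<exists>y\<in>D. (g ** h) ** rho x ** matrix_inv (g ** h) = rho y \<and> f y = f x"
      unfolding e y'(2) y'(3)[symmetric] by (intro bexI[of _ z'] conjI)
  qed
next
  case (inv h)
  have "invertible h"
    by (rule gen_grp_invertible[OF inv.hyps]) (use assms(2,4) rho_invertible in auto)
  then have "matrix_inv (matrix_inv h) = h" using matrix_inv_eq matrix_inv_both(2) by blast
  then show ?case using inv.IH by auto
qed

lemma mset_map_factor:
  assumes "mset (map g X) = mset (map g Y)"
    "\<And>x y. x \<in> set X \<union> set Y \<Longrightarrow> y \<in> set X \<union> set Y \<Longrightarrow> g x = g y \<Longrightarrow> f x = f y"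
  shows "mset (map f X) = mset (map f Y)"
proof -
  define F where "F k = f (SOME x. x \<in> set X \<union> set Y \<and> g x = k)" for k
  have "F (g x) = f x" if "x \<in> set X \<union> set Y" for x
    unfolding F_def
  proof (rule someI2)
    show "x \<in> set X \<union> set Y \<and> g x = g x" using that by simp
    show "f y = f x" if "y \<in> set X \<union> set Y \<and> g y = g x" for y
      using assms(2) that \<open>x \<in> set X \<union> set Y\<close> by blast
  qed
  then have "map f X = map F (map g X)" "map f Y = map F (map g Y)" by simp_all
  then show ?thesis using assms(1) by (metis mset_map)
qed

text \<open>Conjugation by the subgroup stays in \<open>D\<close> and preserves \<open>f\<close>,
  and \<open>rho\<close> is injective on valid pairs, so \<open>f\<close> is a function of the
  conjugacy class.\<close>

lemma conj_class_mset_invariant: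
  assumes "conj_class_mset (map rho X) = conj_class_mset (map rho Y)"
    "gen_grp (rho ` set X) = gen_grp (rho ` set Y)"
    "set X \<subseteq> D" "set Y \<subseteq> D" "invariant_on D f" "\<And>x. x \<in> D \<Longrightarrow> valid x"
  shows "mset (map f X) = mset (map f Y)"
proof (rule mset_map_factor)
  let ?H = "gen_grp (rho ` set X)"
  show "mset (map (conj_class ?H \<circ> rho) X) = mset (map (conj_class ?H \<circ> rho) Y)"
    using assms(1,2) by (simp add: conj_class_mset_def comp_def image_mset.compositionality)
  fix x y assume "x \<in> set X \<union> set Y" "y \<in> set X \<union> set Y"
    and eq: "(conj_class ?H \<circ> rho) x = (conj_class ?H \<circ> rho) y"
  then have xy: "x \<in> D" "y \<in> D" using assms(3,4) by auto
  have "matrix_inv (mat 1) = (mat 1 :: cmat)" by (rule matrix_inv_eq) simp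
  then have "rho x \<in> conj_class ?H (rho x)"
    unfolding conj_class_def using gen_grp.one by force
  then obtain h where h: "h \<in> ?H" "rho x = matrix_inv h ** rho y ** h"
    using eq by (auto simp: conj_class_def)
  then obtain y' where "y' \<in> D" "rho x = rho y'" "f y' = f y"
    using gen_grp_conj[OF h(1) assms(3,5)] assms(6) xy(2) unfolding valid_def by metis
  then show "f x = f y" using rho_inject assms(6) xy(1) by metis
qed

lemma valid_xc: "valid x \<Longrightarrow> valid (xc x y)"
  by (simp add: valid_def xc_def kind_cj)

lemma rho_commute:
  assumes "valid x" "valid y"
  shows "rho x ** rho y = rho y ** rho x \<longleftrightarrow> comm (fst x) (fst y)"
proof
  assume "rho x ** rho y = rho y ** rho x"
  then have "rho (xc x y) = rho x"
    using rho_left_cancel[of y] rho_xc[of x y] assms(2) by (simp add: valid_def)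
  then have "xc x y = x" using rho_inject valid_xc assms(1) by blast
  then show "comm (fst x) (fst y)" by (metis comm_def fst_conv xc_def)
next
  assume "comm (fst x) (fst y)"
  then have "xc x y = x" by (simp add: comm_def xc_def)
  then show "rho x ** rho y = rho y ** rho x" using rho_xc by metis
qed

lemma rho_image_commute:
  assumes "\<And>x. x \<in> set X \<Longrightarrow> valid x" "\<not> noncomm (map fst X)" "r \<in> rho ` set X" "s \<in> rho ` set X"
  shows "r ** s = s ** r"
proof -
  obtain x y where xy: "x \<in> set X" "y \<in> set X" "r = rho x" "s = rho y" using assms(3,4) by blast
  then have "comm (fst x) (fst y)" using assms(2) by (auto simp: noncomm_def)
  then show ?thesis using rho_commute[of x y] assms(1) xy by auto
qed

lemma conj_class_abelian:
  assumes "\<And>x. x \<in> S \<Longrightarrow> invertible x" "\<And>x y. x \<in> S \<Longrightarrow> y \<in> S \<Longrightarrow> x ** y = y ** x" "r \<in> gen_grp S"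
  shows "conj_class (gen_grp S) r = {r}"
proof -
  have fixed: "matrix_inv h ** r ** h = r" if "h \<in> gen_grp S" for h
    using gen_grp_abelian[OF assms(1,2) that assms(3)] gen_grp_invertible[OF that assms(1)]
    by (metis matrix_inv_both(2) matrix_mul_assoc matrix_mul_lid)
  have "conj_class (gen_grp S) r = (\<lambda>h. r) ` gen_grp S"
    unfolding conj_class_def Setcompr_eq_image by (intro image_cong refl fixed)
  moreover have "gen_grp S \<noteq> {}" using gen_grp.one by blast
  ultimately show ?thesis by auto
qed

text \<open>Conjugacy classes are singletons here, so the two lists of matrices agree up to order,
  and every Hurwitz move is a transposition.\<close>

lemma abelian_heq:
  assumes "\<And>x. x \<in> set X \<union> set Y \<Longrightarrow> valid x" "\<not> noncomm (map fst X)"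
    "gen_grp (rho ` set X) = gen_grp (rho ` set Y)"
    "conj_class_mset (map rho X) = conj_class_mset (map rho Y)"
  shows "\<exists>Z. heq X Z \<and> map rho Z = map rho Y"
proof -
  let ?H = "gen_grp (rho ` set X)"
  have inv: "invertible r" if "r \<in> rho ` set X" for r
    using that assms(1) rho_invertible by (auto simp: valid_def)
  have comm: "r ** s = s ** r" if "r \<in> rho ` set X" "s \<in> rho ` set X" for r s
    using rho_image_commute[OF _ assms(2) that] assms(1) by blast
  have single: "conj_class ?H (rho x) = {rho x}" if "x \<in> set X \<union> set Y" for x
  proof -
    have "rho x \<in> ?H"
      using that assms(3) gen_grp.gen[of "rho x" "rho ` set X"] gen_grp.gen[of "rho x" "rho ` set Y"] by auto
    then show ?thesis using conj_class_abelian inv comm by blast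
  qed
  have "mset (map rho X) = mset (map rho Y)"
  proof (rule mset_map_factor)
    show "mset (map (conj_class ?H \<circ> rho) X) = mset (map (conj_class ?H \<circ> rho) Y)"
      using assms(3,4) by (simp add: conj_class_mset_def comp_def image_mset.compositionality)
  qed (simp add: single)
  moreover have "invariant_on (set X) rho"
  proof -
    have "xc x y = x" if "x \<in> set X" "y \<in> set X" for x y
      using assms(2) that by (auto simp: noncomm_def comm_def xc_def)
    then show ?thesis by (simp add: invariant_on_def)
  qed
  ultimately show ?thesis using heq_reorder[of "set X" rho X "map rho Y"] by simp
qed

theorem theorem1p2:
  fixes T V :: "cmat list" and n :: nat
  assumes "refl_fact_G7 n T" and "refl_fact_G7 n V"
  shows "hurwitz_equiv T V \<longleftrightarrow>
           (mat_prod_list T = mat_prod_list V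
            \<and> gen_grp (set T) = gen_grp (set V)
            \<and> conj_class_mset T = conj_class_mset V)"
proof -
  have lift: "\<exists>X. T = map rho X \<and> (\<forall>x\<in>set X. valid x)" if "refl_fact_G7 n T" for T
  proof -
    have "\<forall>r\<in>set T. \<exists>x. valid x \<and> r = rho x"
      using that reflection_rho unfolding refl_fact_G7_def by blast
    then obtain g where "\<forall>r\<in>set T. valid (g r) \<and> r = rho (g r)" by metis
    then show ?thesis by (intro exI[of _ "map g T"]) (simp add: map_idI)
  qed
  obtain X where X: "T = map rho X" "\<And>x. x \<in> set X \<Longrightarrow> valid x" using lift[OF assms(1)] by blast
  obtain Y where Y: "V = map rho Y" "\<And>x. x \<in> set Y \<Longrightarrow> valid x" using lift[OF assms(2)] by blast
  have nz: "0 \<notin> snd ` set X" using X(2) by (auto simp: valid_def)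
  show ?thesis
  proof
    assume "hurwitz_equiv T V"
    moreover have "invertible r" if "r \<in> set T" for r
      using that X rho_invertible by (auto simp: valid_def)
    ultimately show "mat_prod_list T = mat_prod_list V
        \<and> gen_grp (set T) = gen_grp (set V) \<and> conj_class_mset T = conj_class_mset V"
      using hurwitz_equiv_invariants by metis
  next
    assume *: "mat_prod_list T = mat_prod_list V
        \<and> gen_grp (set T) = gen_grp (set V) \<and> conj_class_mset T = conj_class_mset V"
    then have gens: "gen_grp (rho ` set X) = gen_grp (rho ` set Y)"
      and classes: "conj_class_mset (map rho X) = conj_class_mset (map rho Y)"
      and prods: "mat_prod_list (map rho X) = mat_prod_list (map rho Y)"
      by (simp_all add: X(1) Y(1))
    have "\<exists>Z. heq X Z \<and> map rho Z = V"
    proof (cases "noncomm (map fst X)")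
      case False
      then show ?thesis using abelian_heq[OF _ _ gens classes] X(2) Y by blast
    next
      case True
      \<comment> \<open>Commutativity of the entries is commutativity of the generated subgroup,
        which both words share.\<close>
      have ncY: "noncomm (map fst Y)"
      proof (rule ccontr)
        assume nc: "\<not> noncomm (map fst Y)"
        have "r ** s = s ** r" if "r \<in> gen_grp (rho ` set Y)" "s \<in> gen_grp (rho ` set Y)" for r s
        proof (rule gen_grp_abelian[OF _ _ that])
          show "invertible x" if "x \<in> rho ` set Y" for x
            using that Y(2) rho_invertible by (auto simp: valid_def)
        qed (rule rho_image_commute[OF Y(2) nc])
        then have "rho x ** rho y = rho y ** rho x" if "x \<in> set X" "y \<in> set X" for x y
          using that gens gen_grp.gen by blast
        then show False using True X(2) rho_commute by (auto simp: noncomm_def)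
      qed
      have cls: "mset (map cls X) = mset (map cls Y)"
        by (rule conj_class_mset_invariant[OF classes gens, of "{x. valid x}"])
           (use X(2) Y(2) valid_xc in \<open>auto simp: invariant_on_def cls_def xc_def kind_cj\<close>)
      have kds: "kd ` set X = kd ` set Y"
        using mset_cls_kd[OF cls] by (metis list.set_map mset_eq_setD)
      have "heq X Y"
      \<comment> \<open>If all entries have order 4, the axes have to be matched as well; otherwise
        both words are \<open>good\<close> and \<open>cls\<close> suffices.\<close>
      proof (cases "kd ` set X \<subseteq> {Invol}")
        case Invol: True
        let ?D = "{x. valid x} \<inter> Invols"
        have sub: "set X \<subseteq> Invols" "set Y \<subseteq> Invols" using Invol Invol[unfolded kds] by auto
        have "invariant_on ?D ax"
          using invariant_ax valid_xc by (auto simp: invariant_on_def)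
        then have "mset (map ax X) = mset (map ax Y)"
          by (rule conj_class_mset_invariant[OF classes gens, rotated 2])
             (use X(2) Y(2) sub in auto)
        then show ?thesis using Invol_heq[OF sub True nz] prods by blast
      next
        case False
        then have "good (map fst X)" "good (map fst Y)"
          using True ncY kds unfolding good_alt by auto
        then show ?thesis using good_heq nz cls prods by blast
      qed
      then show ?thesis using Y(1) by blast
    qed
    then show "hurwitz_equiv T V" using heq_hurwitz nz X(1) by blast
  qed
qed

end
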